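(* Let $0<\lambda<1$ and let $f\in\mathcal{A}$ have the expansion $f(z)=z+\sum_{n=2}^\infty a_nz^n$, $z\in\mathbb{D}$, with $a_2=0$. Suppose that $U_f\not\equiv 0$ and $$|U_f(z)|\le\lambda|z|^2\quad\text{for all } z\in\mathbb{D}.$$ Then $f$ has a $\lambda$-quasiconformal extension onto $\widehat{\mathbb{C}}$, given explicitly by $$F(z)=\begin{cases} f(z), & |z|<1,\\[1mm] \dfrac{zf(1/\overline{z})}{z-(|z|^2-1)f(1/\overline{z})}, & |z|\ge 1.\end{cases}$$
   Context: $\mathbb{D}=\{z\in\mathbb{C}:|z|<1\}$, $\widehat{\mathbb{C}}=\mathbb{C}\cup\{\infty\}$. $\mathcal{A}$ is the class of analytic functions $f$ on $\mathbb{D}$ with $f(0)=0=f'(0)-1$. For $f\in\mathcal{A}$ put $U_f(z)=(z/f(z))^2f'(z)-1$, $z\in\mathbb{D}$ (with the removable singularity at $0$ filled in; $z/f(z)$ has value $1$ at $0$). A bound on $|U_f|$ in $\mathbb{D}$ means in particular that $U_f$ has no poles there, so $f$ has no zeros in $\mathbb{D}\setminus\{0\}$. For $k\in[0,1)$, a $k$-quasiconformal mapping of $\widehat{\mathbb{C}}$ is a sense-preserving homeomorphism $F:\widehat{\mathbb{C}}\to\widehat{\mathbb{C}}$ belonging to the Sobolev space $W^{1,2}_{\mathrm{loc}}(\widehat{\mathbb{C}})$ with $|F_{\bar z}|\le k|F_z|$ a.e. A $k$-quasiconformal extension onto $\widehat{\mathbb{C}}$ of a conformal map $f$ on a domain $\Omega$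 is such an $F$ with $F|_\Omega=f$. Formulas for $F$ are read as maps into $\widehat{\mathbb{C}}$; the value at $z=\infty$, and values of $f$ on $|z|=1$, are understood by continuous extension. *)

theory Defs
  imports "HOL-Analysis.Analysis" "HOL-Complex_Analysis.Complex_Analysis"
begin

section \<open>The class of normalised functions and the operator U\<close>

definition class_A :: "(complex \<Rightarrow> complex) set" where
  "class_A = {f. f holomorphic_on ball 0 1 \<and> f 0 = 0 \<and> deriv f 0 = 1}"

text \<open>
  At a zero \<open>z \<noteq> 0\<close> of \<open>f\<close>, where the operator below should have a pole, the convention
  \<open>x / 0 = 0\<close> gives it the value \<open>-1\<close>. A bound \<open>\<lambda> * (norm z)^2\<close> on its modulus with
  \<open>\<lambda> < 1\<close> therefore excludes such zeros in the unit disc, as it should.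
\<close>

definition z_over :: "(complex \<Rightarrow> complex) \<Rightarrow> complex \<Rightarrow> complex" where
  "z_over f z = (if z = 0 then 1 else z / f z)"

definition U_op :: "(complex \<Rightarrow> complex) \<Rightarrow> complex \<Rightarrow> complex" where
  "U_op f z = (z_over f z)^2 * deriv f z - 1"


section \<open>The Riemann sphere\<close>

text \<open>\<open>Some z\<close> is the finite point \<open>z\<close>, and \<open>None\<close> is the point at infinity.\<close>

definition riemann_sphere :: "complex option topology" where
  "riemann_sphere = Alexandroff_compactification euclidean"

definition sphere_inv :: "complex option \<Rightarrow> complex option" where
  "sphere_inv p = (case p of None \<Rightarrow> Some 0 | Some z \<Rightarrow> if z = 0 then None else Some (1 / z))"

text \<open>Only used when \<open>a\<close> and \<open>b\<close> do not both vanish.\<close>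

definition sphere_quotient :: "complex \<Rightarrow> complex \<Rightarrow> complex option" where
  "sphere_quotient a b = (if b = 0 then None else Some (a / b))"


section \<open>The local Sobolev space\<close>

fun cont_diff :: "nat \<Rightarrow> (complex \<Rightarrow> real) \<Rightarrow> bool" where
  "cont_diff 0 \<phi> \<longleftrightarrow> continuous_on UNIV \<phi>"
| "cont_diff (Suc n) \<phi> \<longleftrightarrow>
     (\<forall>z. \<phi> differentiable (at z)) \<and>
     (\<forall>v. cont_diff n (\<lambda>z. frechet_derivative \<phi> (at z) v))"

definition test_functions :: "complex set \<Rightarrow> (complex \<Rightarrow> real) set" where
  "test_functions \<Omega> =
     {\<phi>. (\<forall>n. cont_diff n \<phi>) \<and> (\<exists>K. compact K \<and> K \<subseteq> \<Omega> \<and> (\<forall>z. z \<notin> K \<longrightarrow> \<phi> z = 0))}"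

definition L2_loc :: "complex set \<Rightarrow> (complex \<Rightarrow> complex) \<Rightarrow> bool" where
  "L2_loc \<Omega> g \<longleftrightarrow>
     set_borel_measurable lebesgue \<Omega> g \<and>
     (\<forall>K. compact K \<and> K \<subseteq> \<Omega> \<longrightarrow> set_integrable lebesgue K (\<lambda>z. (norm (g z))^2))"

definition weak_derivative ::
    "complex set \<Rightarrow> complex \<Rightarrow> (complex \<Rightarrow> complex) \<Rightarrow> (complex \<Rightarrow> complex) \<Rightarrow> bool" where
  "weak_derivative \<Omega> v g h \<longleftrightarrow>
     (\<forall>\<phi>\<in>test_functions \<Omega>.
        (LINT z:\<Omega>|lebesgue. frechet_derivative \<phi> (at z) v *\<^sub>R g z) =
        - (LINT z:\<Omega>|lebesgue. \<phi> z *\<^sub>R h z))"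

text \<open>
  The function \<open>g\<close> is in the space \<open>W\<close> with exponents (1,2) locally on \<open>\<Omega>\<close>, and \<open>gx\<close>, \<open>gy\<close>
  are (representatives of) its weak partial derivatives; these are unique up to null sets.
\<close>

definition W12_loc_partials ::
    "complex set \<Rightarrow> (complex \<Rightarrow> complex) \<Rightarrow> (complex \<Rightarrow> complex) \<Rightarrow> (complex \<Rightarrow> complex) \<Rightarrow> bool" where
  "W12_loc_partials \<Omega> g gx gy \<longleftrightarrow>
     L2_loc \<Omega> g \<and> L2_loc \<Omega> gx \<and> L2_loc \<Omega> gy \<and>
     weak_derivative \<Omega> 1 g gx \<and> weak_derivative \<Omega> \<i> g gy"


section \<open>Quasiconformal maps of the sphere\<close>

text \<open>Only used for continuous injective \<open>g\<close> on open \<open>\<Omega>\<close>.\<close>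

definition sense_preserving_on :: "complex set \<Rightarrow> (complex \<Rightarrow> complex) \<Rightarrow> bool" where
  "sense_preserving_on \<Omega> g \<longleftrightarrow>
     (\<forall>z\<in>\<Omega>. \<forall>\<^sub>F r in at_right 0. winding_number (g \<circ> circlepath z r) (g z) = 1)"

text \<open>The two quotients are the Wirtinger derivatives of \<open>g\<close> in \<open>cnj z\<close> and in \<open>z\<close>.\<close>

definition dilatation_bound_on :: "real \<Rightarrow> complex set \<Rightarrow> (complex \<Rightarrow> complex) \<Rightarrow> bool" where
  "dilatation_bound_on k \<Omega> g \<longleftrightarrow>
     (\<exists>gx gy. W12_loc_partials \<Omega> g gx gy \<and>
        (AE z in lebesgue. z \<in> \<Omega> \<longrightarrow>
           norm ((gx z + \<i> * gy z) / 2) \<le> k * norm ((gx z - \<i> * gy z) / 2)))"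

definition finite_dom :: "(complex option \<Rightarrow> complex option) \<Rightarrow> complex set" where
  "finite_dom G = {z. G (Some z) \<noteq> None}"

definition coord_rep :: "(complex option \<Rightarrow> complex option) \<Rightarrow> complex \<Rightarrow> complex" where
  "coord_rep G z = the (G (Some z))"

text \<open>
  The local conditions are imposed on all four expressions of \<open>F\<close> in the charts \<open>z\<close> and \<open>1/z\<close>
  of the source and of the target, so also near infinity and near the preimage of infinity.
\<close>

definition quasiconformal_sphere :: "real \<Rightarrow> (complex option \<Rightarrow> complex option) \<Rightarrow> bool" where
  "quasiconformal_sphere k F \<longleftrightarrow>
     0 \<le> k \<and> k < 1 \<and>
     homeomorphic_map riemann_sphere riemann_sphere F \<and>
     (\<forall>\<sigma>\<in>{id, sphere_inv}. \<forall>\<tau>\<in>{id, sphere_inv}.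
        let G = \<tau> \<circ> F \<circ> \<sigma> in
          sense_preserving_on (finite_dom G) (coord_rep G) \<and>
          dilatation_bound_on k (finite_dom G) (coord_rep G))"

definition qc_extension ::
    "real \<Rightarrow> complex set \<Rightarrow> (complex \<Rightarrow> complex) \<Rightarrow> (complex option \<Rightarrow> complex option) \<Rightarrow> bool" where
  "qc_extension k \<Omega> f F \<longleftrightarrow>
     f holomorphic_on \<Omega> \<and> inj_on f \<Omega> \<and>
     quasiconformal_sphere k F \<and> (\<forall>z\<in>\<Omega>. F (Some z) = Some (f z))"


section \<open>The explicit formula\<close>

definition closed_disc_extension ::
    "(complex \<Rightarrow> complex) \<Rightarrow> (complex \<Rightarrow> complex option) \<Rightarrow> bool" where
  "closed_disc_extension f fhat \<longleftrightarrow>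
     continuous_map (top_of_set (cball 0 1)) riemann_sphere fhat \<and>
     (\<forall>z\<in>ball 0 1. fhat z = Some (f z))"

text \<open>
  The map \<open>w \<mapsto> z w / (z - (|z|^2 - 1) w)\<close> for \<open>z \<noteq> 0\<close>, with its value at \<open>w = \<infinity>\<close>
  determined by continuity (for \<open>norm z = 1\<close> it is the identity).
\<close>

definition exterior_formula :: "complex \<Rightarrow> complex option \<Rightarrow> complex option" where
  "exterior_formula z p =
     (case p of
        Some w \<Rightarrow> sphere_quotient (z * w) (z - of_real ((norm z)^2 - 1) * w)
      | None \<Rightarrow> sphere_quotient z (- of_real ((norm z)^2 - 1)))"

end

theory Submission
  imports Defs
begin

text \<open>
  Writing \<open>1 / f z = 1 / z + h z\<close>, the condition \<open>a 2 = 0\<close> gives \<open>h 0 = 0\<close>, and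
  \<open>U_op f z = - z^2 * deriv h z\<close>, so that the hypothesis says that \<open>h\<close> is \<open>lam\<close>-Lipschitz.
  In the coordinate \<open>w = 1 / z\<close> on both sides, the map in question is \<open>G w = w + h (\<rho> w)\<close>,
  where \<open>\<rho> w = cnj w\<close> in the closed disc and \<open>\<rho> w = 1 / w\<close> outside. As \<open>\<rho>\<close> is 1-Lipschitz,
  \<open>G\<close> is a perturbation of the identity by a contraction, hence a homeomorphism by Banach's
  fixed point theorem. It fixes \<open>0\<close>, so all four coordinate expressions are locally Lipschitz, and
  they are differentiable off the unit circle, where the dilatation is at most
  \<open>norm (deriv h (cnj w))\<close>.
\<close>

subsection \<open>Pointwise quasiconformality\<close>

text \<open>The map \<open>G\<close> is read off from the exterior formula: with
  \<open>u = 1 / cnj z\<close> its reciprocal is \<open>1 / z + 1 / f u - cnj z\<close>, and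
  \<open>1 / f u = cnj z + h u\<close> turns this into \<open>1 / z + h u\<close>. The obstacle is
  the unit circle, where \<open>h\<close> has only a Lipschitz extension and \<open>G\<close> need
  not have a derivative. So each analytic requirement is reduced to a pointwise condition that
  survives composition with \<open>1 / z\<close> on either side: a Lipschitz bound for the Sobolev
  condition, approximation by a nonzero complex linear map with relative error below 1 for the
  orientation, and a bound on the Wirtinger derivatives off the circle, a null set. The Lipschitz
  bound turns classical derivatives into weak ones through dominated convergence of difference
  quotients. One point escapes this transport between charts: at \<open>z = 0\<close> the map
  involves \<open>G\<close> near infinity. There it is handled as \<open>f\<close> itself, which is
  conformal with derivative 1.\<close>

definition lipschitz_near :: "(complex \<Rightarrow> complex) \<Rightarrow> complex \<Rightarrow> bool" where
  "lipschitz_near g z \<longleftrightarrow>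
     (\<exists>e>0. \<exists>L. \<forall>x\<in>ball z e. \<forall>y\<in>ball z e. norm (g x - g y) \<le> L * norm (x - y))"

text \<open>
  Holds also at points of the unit circle, where there is no derivative, and suffices to determine
  the local winding number.
\<close>

definition near_linear :: "(complex \<Rightarrow> complex) \<Rightarrow> complex \<Rightarrow> bool" where
  "near_linear g z \<longleftrightarrow>
     (\<exists>c \<mu>. c \<noteq> 0 \<and> 0 \<le> \<mu> \<and> \<mu> < 1 \<and>
        (\<forall>\<^sub>F w in nhds z. norm (g w - g z - c * (w - z)) \<le> \<mu> * norm (c * (w - z))))"

text \<open>The numbers \<open>p\<close> and \<open>q\<close> are the Wirtinger derivatives in z and
  in cnj z. Composition with a conformal map multiplies both by factors of the same modulus, so the
  inequality carries over.\<close>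

definition dilatation_at :: "real \<Rightarrow> (complex \<Rightarrow> complex) \<Rightarrow> complex \<Rightarrow> bool" where
  "dilatation_at k g z \<longleftrightarrow>
     (\<exists>p q. (g has_derivative (\<lambda>v. p * v + q * cnj v)) (at z) \<and> norm q \<le> k * norm p)"

text \<open>In the application \<open>E\<close> is the unit circle. Inversion maps it to itself, so
  that one exceptional set serves all four charts.\<close>

definition qc_at :: "real \<Rightarrow> complex set \<Rightarrow> (complex \<Rightarrow> complex) \<Rightarrow> complex \<Rightarrow> bool" where
  "qc_at k E g z \<longleftrightarrow>
     lipschitz_near g z \<and> near_linear g z \<and> (z \<notin> E \<longrightarrow> dilatation_at k g z)"

lemma lipschitz_nearE:
  assumes "lipschitz_near g z"
  obtains e L where "0 < e" "0 \<le> L"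
    "\<And>x y. x \<in> ball z e \<Longrightarrow> y \<in> ball z e \<Longrightarrow> norm (g x - g y) \<le> L * norm (x - y)"
proof -
  obtain e L where eL: "e > 0" "\<forall>x\<in>ball z e. \<forall>y\<in>ball z e. norm (g x - g y) \<le> L * norm (x - y)"
    using assms by (auto simp: lipschitz_near_def)
  have "norm (g x - g y) \<le> max L 0 * norm (x - y)" if "x \<in> ball z e" "y \<in> ball z e" for x y
    using eL(2) that mult_right_mono[of L "max L 0" "norm (x - y)"] by force
  with eL(1) show thesis by (intro that[of e "max L 0"]) auto
qed

lemma lipschitz_near_isCont:
  assumes "lipschitz_near g z"
  shows "isCont g z"
proof -
  obtain e L where e: "0 < e" "0 \<le> L"
    "\<And>x y. x \<in> ball z e \<Longrightarrow> y \<in> ball z e \<Longrightarrow> norm (g x - g y) \<le> L * norm (x - y)"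
    using assms by (rule lipschitz_nearE) blast
  have "L-lipschitz_on (ball z e) g"
    using e by (auto simp: lipschitz_on_def dist_norm)
  then have "continuous_on (ball z e) g"
    by (rule lipschitz_on_continuous_on)
  then show ?thesis
    using e(1) by (simp add: continuous_on_eq_continuous_at)
qed

lemma lipschitz_nearI:
  assumes "\<And>x y. x \<in> ball z d \<Longrightarrow> y \<in> ball z d \<Longrightarrow> norm (g x - g y) \<le> L * norm (x - y)" "0 < d"
  shows "lipschitz_near g z"
  using assms unfolding lipschitz_near_def by blast

lemma eventually_nhds_ballE:
  fixes z :: "'a::metric_space"
  assumes "\<forall>\<^sub>F w in nhds z. P w"
  obtains d where "0 < d" "\<And>w. w \<in> ball z d \<Longrightarrow> P w"
  using assms by (auto simp: eventually_nhds_metric dist_commute)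

lemma isCont_eventually_nhds:
  assumes "isCont g z" "\<forall>\<^sub>F u in nhds (g z). P u"
  shows "\<forall>\<^sub>F w in nhds z. P (g w)"
  using assms eventually_compose_filterlim
  by (fastforce simp: isCont_def tendsto_at_iff_tendsto_nhds)

lemma qc_at_cong:
  assumes eq: "\<forall>\<^sub>F w in nhds z. f w = g w" and f: "qc_at k E f z"
  shows "qc_at k E g z"
proof -
  have z: "f z = g z" using eq by (rule eventually_nhds_x_imp_x)
  obtain d where d: "0 < d" "\<And>w. w \<in> ball z d \<Longrightarrow> f w = g w"
    using eq by (rule eventually_nhds_ballE) blast
  have "lipschitz_near g z"
  proof -
    obtain e L where e: "0 < e" "0 \<le> L"
      "\<And>x y. x \<in> ball z e \<Longrightarrow> y \<in> ball z e \<Longrightarrow> norm (f x - f y) \<le> L * norm (x - y)"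
      using f lipschitz_nearE unfolding qc_at_def by metis
    show ?thesis
    proof (rule lipschitz_nearI)
      show "norm (g x - g y) \<le> L * norm (x - y)" 
        if "x \<in> ball z (min d e)" "y \<in> ball z (min d e)" for x y
        using that e(3)[of x y] d(2)[of x] d(2)[of y] by auto
    qed (use d e in auto)
  qed
  moreover have "near_linear g z"
  proof -
    obtain c \<mu> where c: "c \<noteq> 0" "0 \<le> \<mu>" "\<mu> < 1"
      "\<forall>\<^sub>F w in nhds z. norm (f w - f z - c * (w - z)) \<le> \<mu> * norm (c * (w - z))"
      using f unfolding qc_at_def near_linear_def by blast
    have "\<forall>\<^sub>F w in nhds z. norm (g w - g z - c * (w - z)) \<le> \<mu> * norm (c * (w - z))"
      using c(4) eq by eventually_elim (simp add: z)
    with c show ?thesis unfolding near_linear_def by blast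
  qed
  moreover have "dilatation_at k g z" if "dilatation_at k f z"
  proof -
    obtain p q where p: "(f has_derivative (\<lambda>v. p * v + q * cnj v)) (at z)" "norm q \<le> k * norm p"
      using \<open>dilatation_at k f z\<close> unfolding dilatation_at_def by blast
    have "(g has_derivative (\<lambda>v. p * v + q * cnj v)) (at z)"
      by (rule has_derivative_transform_within_open[OF p(1) open_ball[of z d]])
         (use d in auto)
    with p(2) show ?thesis unfolding dilatation_at_def by blast
  qed
  ultimately show ?thesis
    using f by (auto simp: qc_at_def)
qed

lemma has_field_derivative_eventually_le:
  fixes \<phi> :: "complex \<Rightarrow> complex"
  assumes "(\<phi> has_field_derivative d) (at z)" "0 < \<epsilon>"
  shows "\<forall>\<^sub>F w in nhds z. norm (\<phi> w - \<phi> z - d * (w - z)) \<le> \<epsilon> * norm (w - z)"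
proof -
  have "(\<phi> has_derivative (*) d) (at z)"
    using assms(1) by (simp add: has_field_derivative_def)
  then obtain r where "0 < r"
    "\<And>w. norm (w - z) < r \<Longrightarrow> norm (\<phi> w - \<phi> z - d * (w - z)) \<le> \<epsilon> * norm (w - z)"
    using assms(2) by (auto simp: has_derivative_at_alt)
  then show ?thesis
    by (auto simp: eventually_nhds_metric dist_norm)
qed

lemma holomorphic_lipschitz_near:
  assumes "\<phi> holomorphic_on S" "open S" "z \<in> S"
  shows "lipschitz_near \<phi> z"
proof -
  obtain e where e: "0 < e" "cball z e \<subseteq> S"
    using assms open_contains_cball by blast
  have "continuous_on (cball z e) (deriv \<phi>)"
    using holomorphic_on_subset[OF holomorphic_deriv[OF assms(1,2)] e(2)]
    by (rule holomorphic_on_imp_continuous_on)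
  then have "bounded (deriv \<phi> ` cball z e)"
    by (intro compact_imp_bounded compact_continuous_image) auto
  then obtain B where B: "\<And>w. w \<in> cball z e \<Longrightarrow> norm (deriv \<phi> w) \<le> B"
    unfolding bounded_iff by blast
  show ?thesis
  proof (rule lipschitz_nearI)
    show "norm (\<phi> x - \<phi> y) \<le> B * norm (x - y)" if "x \<in> ball z e" "y \<in> ball z e" for x y
    proof (rule field_differentiable_bound[of "ball z e" \<phi> "deriv \<phi>"])
      show "(\<phi> has_field_derivative deriv \<phi> w) (at w within ball z e)" if "w \<in> ball z e" for w
        using holomorphic_derivI[OF assms(1,2), of w] subsetD[OF e(2), of w] that by auto
    qed (use that B in auto)
  qed (use e in auto)
qed

lemma holomorphic_near_linear:
  assumes "\<phi> holomorphic_on S" "open S" "z \<in> S" "deriv \<phi> z \<noteq> 0"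
  shows "near_linear \<phi> z"
proof -
  have "\<forall>\<^sub>F w in nhds z. norm (\<phi> w - \<phi> z - deriv \<phi> z * (w - z)) \<le> (norm (deriv \<phi> z) / 2) * norm (w - z)"
    using assms by (intro has_field_derivative_eventually_le holomorphic_derivI) auto
  then have "\<forall>\<^sub>F w in nhds z. norm (\<phi> w - \<phi> z - deriv \<phi> z * (w - z)) \<le> (1/2) * norm (deriv \<phi> z * (w - z))"
    by eventually_elim (simp add: norm_mult)
  then show ?thesis using assms(4) unfolding near_linear_def
    by (intro exI[of _ "deriv \<phi> z"] exI[of _ "1/2"]) auto
qed

lemma holomorphic_qc_at:
  assumes "\<phi> holomorphic_on S" "open S" "z \<in> S" "deriv \<phi> z \<noteq> 0" "0 \<le> k"
  shows "qc_at k E \<phi> z"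
proof -
  have "(\<phi> has_derivative (*) (deriv \<phi> z)) (at z)"
    using assms holomorphic_derivI has_field_derivative_imp_has_derivative by blast
  then have "(\<phi> has_derivative (\<lambda>v. deriv \<phi> z * v + 0 * cnj v)) (at z)" 
    by (auto elim: has_derivative_eq_rhs)
  then have "dilatation_at k \<phi> z" unfolding dilatation_at_def
    using assms(5) by (intro exI[of _ "deriv \<phi> z"] exI[of _ 0]) auto
  then show ?thesis
    unfolding qc_at_def
    using holomorphic_lipschitz_near[OF assms(1-3)] holomorphic_near_linear[OF assms(1-4)] by blast
qed

text \<open>The nonlinear part of \<phi> is o(|u - g z|), and a relative error \<mu> strictly below
  1 leaves room to absorb it.\<close>

lemma qc_at_post_conformal:
  assumes g: "qc_at k E g z" 
    and \<phi>: "\<phi> holomorphic_on S" "open S" "g z \<in> S" "deriv \<phi> (g z) \<noteq> 0"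
  shows "qc_at k E (\<lambda>w. \<phi> (g w)) z"
proof -
  define d where "d = deriv \<phi> (g z)"
  have lip: "lipschitz_near g z" using g by (simp add: qc_at_def)
  then have cont: "isCont g z" by (rule lipschitz_near_isCont)
  have d: "(\<phi> has_field_derivative d) (at (g z))" "d \<noteq> 0"
    using \<phi> holomorphic_derivI unfolding d_def by blast+
  have "lipschitz_near (\<lambda>w. \<phi> (g w)) z"
  proof -
    obtain e L where e: "0 < e" "0 \<le> L"
      "\<And>x y. x \<in> ball z e \<Longrightarrow> y \<in> ball z e \<Longrightarrow> norm (g x - g y) \<le> L * norm (x - y)"
      using lip by (rule lipschitz_nearE) blast
    obtain e' L' where e': "0 < e'" "0 \<le> L'"
      "\<And>x y. x \<in> ball (g z) e' \<Longrightarrow> y \<in> ball (g z) e' \<Longrightarrow> norm (\<phi> x - \<phi> y) \<le> L' * norm (x - y)"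
      using holomorphic_lipschitz_near[OF \<phi>(1-3)] by (rule lipschitz_nearE) blast
    have "\<forall>\<^sub>F w in nhds z. g w \<in> ball (g z) e'"
      using e'(1) by (intro isCont_eventually_nhds[OF cont] eventually_nhds_in_open) auto
    then obtain r where r: "0 < r" "\<And>w. w \<in> ball z r \<Longrightarrow> g w \<in> ball (g z) e'"
      by (rule eventually_nhds_ballE) blast
    show ?thesis
    proof (rule lipschitz_nearI)
      fix x y assume "x \<in> ball z (min e r)" "y \<in> ball z (min e r)"
      then have "norm (\<phi> (g x) - \<phi> (g y)) \<le> L' * norm (g x - g y)" "norm (g x - g y) \<le> L * norm (x - y)"
        using e'(3)[of "g x" "g y"] r(2) e(3) by auto
      then show "norm (\<phi> (g x) - \<phi> (g y)) \<le> (L' * L) * norm (x - y)"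
        using e'(2) by (metis mult.assoc mult_left_mono order_trans)
    qed (use e r in auto)
  qed
  moreover have "near_linear (\<lambda>w. \<phi> (g w)) z"
  proof -
    obtain c \<mu> where c: "c \<noteq> 0" "0 \<le> \<mu>" "\<mu> < 1"
      "\<forall>\<^sub>F w in nhds z. norm (g w - g z - c * (w - z)) \<le> \<mu> * norm (c * (w - z))"
      using g unfolding qc_at_def near_linear_def by blast
    \<comment> \<open>The factor \<epsilon> will be applied to |g w - g z|, which is at most 2|c (w
      - z)|. With this choice the relative error becomes \<mu> + (1 - \<mu>)/2 = (1 + \<mu>)/2,
      still below 1.\<close>
    define \<epsilon> where "\<epsilon> = norm d * (1 - \<mu>) / 4"
    have \<epsilon>: "0 < \<epsilon>" using c d by (simp add: \<epsilon>_def)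
    have "\<forall>\<^sub>F u in nhds (g z). norm (\<phi> u - \<phi> (g z) - d * (u - g z)) \<le> \<epsilon> * norm (u - g z)"
      using d \<epsilon> by (intro has_field_derivative_eventually_le)
    then have "\<forall>\<^sub>F w in nhds z. norm (\<phi> (g w) - \<phi> (g z) - d * (g w - g z)) \<le> \<epsilon> * norm (g w - g z)"
      by (rule isCont_eventually_nhds[OF cont])
    then have "\<forall>\<^sub>F w in nhds z. norm (\<phi> (g w) - \<phi> (g z) - (d * c) * (w - z)) \<le> ((1 + \<mu>) / 2) * norm ((d * c) * (w - z))"
      using c(4)
    proof eventually_elim
      case (elim w)
      let ?n = "norm (c * (w - z))"
      have 1: "norm (g w - g z) \<le> 2 * ?n"
      proof -
        have "norm (g w - g z) \<le> norm (g w - g z - c * (w - z)) + ?n"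
          by (metis diff_add_cancel norm_triangle_ineq)
        also have "\<dots> \<le> \<mu> * ?n + ?n" using elim by simp
        also have "\<dots> \<le> 2 * ?n" using c mult_right_mono[of \<mu> 1 ?n] by simp
        finally show ?thesis .
      qed
      have "\<phi> (g w) - \<phi> (g z) - (d * c) * (w - z) =
          (\<phi> (g w) - \<phi> (g z) - d * (g w - g z)) + d * (g w - g z - c * (w - z))"
        by (simp add: algebra_simps)
      then have "norm (\<phi> (g w) - \<phi> (g z) - (d * c) * (w - z)) \<le>
          norm (\<phi> (g w) - \<phi> (g z) - d * (g w - g z)) + norm (d * (g w - g z - c * (w - z)))"
        by (metis norm_triangle_ineq)
      also have "\<dots> \<le> \<epsilon> * norm (g w - g z) + norm d * (\<mu> * ?n)"
        using elim by (auto simp: norm_mult[of d] intro!: add_mono mult_left_mono)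
      also have "\<dots> \<le> \<epsilon> * (2 * ?n) + norm d * (\<mu> * ?n)"
        using 1 \<epsilon> by simp
      also have "\<dots> = ((1 + \<mu>) / 2) * norm ((d * c) * (w - z))"
        using norm_mult[of d "c * (w - z)"] by (simp add: \<epsilon>_def mult.assoc[of d]) (simp add: algebra_simps)
      finally show ?case .
    qed
    moreover have "d * c \<noteq> 0" "0 \<le> (1 + \<mu>) / 2" "(1 + \<mu>) / 2 < 1" using c d by auto
    ultimately show ?thesis unfolding near_linear_def by blast
  qed
  moreover have "dilatation_at k (\<lambda>w. \<phi> (g w)) z" if dil: "dilatation_at k g z"
  proof -
    obtain p q where p: "(g has_derivative (\<lambda>v. p * v + q * cnj v)) (at z)" "norm q \<le> k * norm p"
      using dil unfolding dilatation_at_def by blast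
    have "((\<lambda>w. \<phi> (g w)) has_derivative (\<lambda>v. d * (p * v + q * cnj v))) (at z)"
      using p(1) d(1) has_derivative_compose[of g _ z UNIV \<phi> "(*) d"]
      by (auto simp: has_field_derivative_def)
    then have "((\<lambda>w. \<phi> (g w)) has_derivative (\<lambda>v. (d * p) * v + (d * q) * cnj v)) (at z)"
      by (simp add: algebra_simps)
    moreover have "norm (d * q) \<le> k * norm (d * p)"
      using mult_left_mono[OF p(2), of "norm d"] by (simp add: norm_mult algebra_simps)
    ultimately show ?thesis unfolding dilatation_at_def by blast
  qed
  ultimately show ?thesis
    using g by (auto simp: qc_at_def)
qed

text \<open>The error \<epsilon> of \<phi> now enters twice, through \<mu> and directly, with total
  weight 1 + \<mu> < 2; hence the same \<epsilon> and the same new error (1 + \<mu>)/2 as for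
  composition on the left. The condition on \<open>E\<close> makes the derivative of
  \<open>g\<close> at \<open>\<phi> z\<close> available whenever \<open>z\<close> is not
  exceptional.\<close>

lemma qc_at_pre_conformal:
  assumes \<phi>: "\<phi> holomorphic_on S" "open S" "z \<in> S" "deriv \<phi> z \<noteq> 0"
    and g: "qc_at k E g (\<phi> z)" and E: "z \<notin> E \<Longrightarrow> \<phi> z \<notin> E"
  shows "qc_at k E (\<lambda>w. g (\<phi> w)) z"
proof -
  define d where "d = deriv \<phi> z"
  have lip: "lipschitz_near \<phi> z" using \<phi> holomorphic_lipschitz_near by blast
  then have cont: "isCont \<phi> z" by (rule lipschitz_near_isCont)
  have d: "(\<phi> has_field_derivative d) (at z)" "d \<noteq> 0"
    using \<phi> holomorphic_derivI unfolding d_def by blast+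
  have "lipschitz_near (\<lambda>w. g (\<phi> w)) z"
  proof -
    obtain e L where e: "0 < e" "0 \<le> L"
      "\<And>x y. x \<in> ball z e \<Longrightarrow> y \<in> ball z e \<Longrightarrow> norm (\<phi> x - \<phi> y) \<le> L * norm (x - y)"
      using lip by (rule lipschitz_nearE) blast
    obtain e' L' where e': "0 < e'" "0 \<le> L'"
      "\<And>x y. x \<in> ball (\<phi> z) e' \<Longrightarrow> y \<in> ball (\<phi> z) e' \<Longrightarrow> norm (g x - g y) \<le> L' * norm (x - y)"
      using g lipschitz_nearE unfolding qc_at_def by metis
    have "\<forall>\<^sub>F w in nhds z. \<phi> w \<in> ball (\<phi> z) e'"
      using e'(1) by (intro isCont_eventually_nhds[OF cont] eventually_nhds_in_open) auto
    then obtain r where r: "0 < r" "\<And>w. w \<in> ball z r \<Longrightarrow> \<phi> w \<in> ball (\<phi> z) e'"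
      by (rule eventually_nhds_ballE) blast
    show ?thesis
    proof (rule lipschitz_nearI)
      fix x y assume "x \<in> ball z (min e r)" "y \<in> ball z (min e r)"
      then have "norm (g (\<phi> x) - g (\<phi> y)) \<le> L' * norm (\<phi> x - \<phi> y)" "norm (\<phi> x - \<phi> y) \<le> L * norm (x - y)"
        using e'(3)[of "\<phi> x" "\<phi> y"] r(2) e(3) by auto
      then show "norm (g (\<phi> x) - g (\<phi> y)) \<le> (L' * L) * norm (x - y)"
        using e'(2) by (metis mult.assoc mult_left_mono order_trans)
    qed (use e r in auto)
  qed
  moreover have "near_linear (\<lambda>w. g (\<phi> w)) z"
  proof -
    obtain c \<mu> where c: "c \<noteq> 0" "0 \<le> \<mu>" "\<mu> < 1"
      "\<forall>\<^sub>F w in nhds (\<phi> z). norm (g w - g (\<phi> z) - c * (w - \<phi> z)) \<le> \<mu> * norm (c * (w - \<phi> z))"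
      using g unfolding qc_at_def near_linear_def by blast
    define \<epsilon> where "\<epsilon> = norm d * (1 - \<mu>) / 4"
    have \<epsilon>: "0 < \<epsilon>" using c d by (simp add: \<epsilon>_def)
    have "\<forall>\<^sub>F w in nhds z. norm (g (\<phi> w) - g (\<phi> z) - c * (\<phi> w - \<phi> z)) \<le> \<mu> * norm (c * (\<phi> w - \<phi> z))"
      by (rule isCont_eventually_nhds[OF cont c(4)])
    moreover have "\<forall>\<^sub>F w in nhds z. norm (\<phi> w - \<phi> z - d * (w - z)) \<le> \<epsilon> * norm (w - z)"
      using d \<epsilon> by (intro has_field_derivative_eventually_le)
    ultimately have "\<forall>\<^sub>F w in nhds z. norm (g (\<phi> w) - g (\<phi> z) - (c * d) * (w - z)) \<le> ((1 + \<mu>) / 2) * norm ((c * d) * (w - z))"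
    proof eventually_elim
      case (elim w)
      let ?n = "norm (w - z)"
      have 1: "norm (\<phi> w - \<phi> z) \<le> (norm d + \<epsilon>) * ?n"
      proof -
        have "norm (\<phi> w - \<phi> z) \<le> norm (\<phi> w - \<phi> z - d * (w - z)) + norm (d * (w - z))"
          by (metis diff_add_cancel norm_triangle_ineq)
        then show ?thesis using elim by (simp add: norm_mult[of d] distrib_right)
      qed
      have "g (\<phi> w) - g (\<phi> z) - (c * d) * (w - z) =
          (g (\<phi> w) - g (\<phi> z) - c * (\<phi> w - \<phi> z)) + c * (\<phi> w - \<phi> z - d * (w - z))"
        by (simp add: algebra_simps)
      then have "norm (g (\<phi> w) - g (\<phi> z) - (c * d) * (w - z)) \<le>
          norm (g (\<phi> w) - g (\<phi> z) - c * (\<phi> w - \<phi> z)) + norm (c * (\<phi> w - \<phi> z - d * (w - z)))"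
        by (metis norm_triangle_ineq)
      also have "\<dots> \<le> \<mu> * (norm c * norm (\<phi> w - \<phi> z)) + norm c * (\<epsilon> * ?n)"
        using elim by (auto simp: norm_mult[of c] intro!: add_mono mult_left_mono)
      also have "\<dots> \<le> \<mu> * (norm c * ((norm d + \<epsilon>) * ?n)) + norm c * (\<epsilon> * ?n)"
        using 1 c \<epsilon> by (intro add_mono mult_left_mono) auto
      also have "\<dots> = norm c * ?n * (\<mu> * norm d + (1 + \<mu>) * \<epsilon>)"
        by (simp add: algebra_simps)
      also have "\<dots> \<le> norm c * ?n * (\<mu> * norm d + 2 * \<epsilon>)"
        using c \<epsilon> by (intro mult_left_mono add_mono mult_right_mono) auto
      also have "\<dots> = ((1 + \<mu>) / 2) * norm ((c * d) * (w - z))"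
        by (simp only: \<epsilon>_def norm_mult) (simp add: field_simps)
      finally show ?case .
    qed
    moreover have "c * d \<noteq> 0" "0 \<le> (1 + \<mu>) / 2" "(1 + \<mu>) / 2 < 1" using c d by auto
    ultimately show ?thesis unfolding near_linear_def by blast
  qed
  moreover have "dilatation_at k (\<lambda>w. g (\<phi> w)) z" if dil: "dilatation_at k g (\<phi> z)"
  proof -
    obtain p q where p: "(g has_derivative (\<lambda>v. p * v + q * cnj v)) (at (\<phi> z))" "norm q \<le> k * norm p"
      using dil unfolding dilatation_at_def by blast
    have "(\<phi> has_derivative (*) d) (at z)" using d(1) by (simp add: has_field_derivative_def)
    from has_derivative_compose[OF this p(1)]
    have "((\<lambda>w. g (\<phi> w)) has_derivative (\<lambda>v. p * (d * v) + q * cnj (d * v))) (at z)" .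
    then have "((\<lambda>w. g (\<phi> w)) has_derivative (\<lambda>v. (p * d) * v + (q * cnj d) * cnj v)) (at z)"
      by (simp add: algebra_simps)
    moreover have "norm (q * cnj d) \<le> k * norm (p * d)"
      using mult_left_mono[OF p(2), of "norm d"] by (simp add: norm_mult algebra_simps)
    ultimately show ?thesis unfolding dilatation_at_def by blast
  qed
  ultimately show ?thesis
    using g E by (auto simp: qc_at_def)
qed

section \<open>Local winding numbers\<close>

lemma winding_number_scaled_circle:
  assumes "c \<noteq> 0" "0 < r"
  shows "winding_number (\<lambda>t. c * (circlepath z r t - z)) 0 = 1"
proof -
  define l where "l = Ln (c * of_real r)"
  \<comment> \<open>The lift of the scaled circle through \<open>exp\<close> is a segment whose ends
    differ by 2 pi \<i>.\<close>
  define p where "p = linepath l (l + 2 * of_real pi * \<i>)"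
  have l: "exp l = c * of_real r" using assms by (simp add: l_def)
  have "(\<lambda>t. c * (circlepath z r t - z)) = exp \<circ> p"
  proof
    fix t
    have "p t = l + 2 * of_real pi * \<i> * of_real t"
      by (simp add: p_def linepath_def scaleR_conv_of_real algebra_simps)
    then show "c * (circlepath z r t - z) = (exp \<circ> p) t"
      by (simp add: circlepath exp_add l mult_ac)
  qed
  moreover have "winding_number (exp \<circ> p) 0 = (pathfinish p - pathstart p) / (2 * of_real pi * \<i>)"
    by (rule winding_number_compose_exp) (simp add: p_def)
  ultimately show ?thesis by (simp add: p_def)
qed

text \<open>On a small circle the image loop is closer to the loop of its linear part than that loop
  is to the origin, so both wind equally often.\<close>

lemma near_linear_winding_number:
  assumes "near_linear g z" "open \<Omega>" "z \<in> \<Omega>" "continuous_on \<Omega> g"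
  shows "\<forall>\<^sub>F r in at_right 0. winding_number (g \<circ> circlepath z r) (g z) = 1"
proof -
  obtain c \<mu> where c: "c \<noteq> 0" "0 \<le> \<mu>" "\<mu> < 1"
    "\<forall>\<^sub>F w in nhds z. norm (g w - g z - c * (w - z)) \<le> \<mu> * norm (c * (w - z))"
    using assms unfolding near_linear_def by blast
  have "\<forall>\<^sub>F w in nhds z. w \<in> \<Omega>"
    using assms by (simp add: eventually_nhds_in_open)
  then have "\<forall>\<^sub>F w in nhds z. w \<in> \<Omega> \<and> norm (g w - g z - c * (w - z)) \<le> \<mu> * norm (c * (w - z))"
    using c(4) by eventually_elim auto
  then obtain e where e: "0 < e" "\<And>w. w \<in> ball z e \<Longrightarrow>
      w \<in> \<Omega> \<and> norm (g w - g z - c * (w - z)) \<le> \<mu> * norm (c * (w - z))"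
    by (rule eventually_nhds_ballE) blast
  have "winding_number (g \<circ> circlepath z r) (g z) = 1" if r: "0 < r" "r < e" for r
  proof -
    have im: "circlepath z r t \<in> ball z e" for t
      using r by (auto simp: circlepath dist_norm norm_mult)
    have "path_image (circlepath z r) \<subseteq> \<Omega>"
      using im e unfolding path_image_def by blast
    then have "path (g \<circ> circlepath z r)"
      using assms(4) by (intro path_continuous_image) (auto intro: continuous_on_subset)
    then have "path (\<lambda>t. g (circlepath z r t) - g z)"
      unfolding path_def by (auto intro!: continuous_intros simp: o_def)
    moreover have "path (\<lambda>t. c * (circlepath z r t - z))"
      unfolding path_def circlepath by (intro continuous_intros)
    moreover have "circlepath z r 1 = circlepath z r 0"
      by (metis pathfinish_circlepath pathfinish_def pathstart_circlepath pathstart_def)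
    ultimately have "winding_number (\<lambda>t. g (circlepath z r t) - g z) 0 =
        winding_number (\<lambda>t. c * (circlepath z r t - z)) 0"
    proof (intro winding_number_nearby_loops_eq)
      fix t :: real
      have "norm (circlepath z r t - z) = r"
        using r by (simp add: circlepath norm_mult)
      then have "norm (c * (circlepath z r t - z)) > 0" using r c by (simp add: norm_mult)
      then have "\<mu> * norm (c * (circlepath z r t - z)) < norm (c * (circlepath z r t - z))"
        using c by simp
      then show "norm (g (circlepath z r t) - g z - c * (circlepath z r t - z)) <
           norm (c * (circlepath z r t - z) - 0)"
        using e(2)[OF im[of t]] by simp
    qed (auto simp: pathfinish_def pathstart_def)
    moreover have "winding_number (g \<circ> circlepath z r) (g z) = winding_number (\<lambda>t. g (circlepath z r t) - g z) 0"
      by (subst winding_number_offset) (simp add: o_def)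
    ultimately show ?thesis
      using winding_number_scaled_circle[OF c(1) r(1)] by simp
  qed
  then show ?thesis
    using e(1) by (auto simp: eventually_at_right_field)
qed

subsection \<open>Weak derivatives of locally Lipschitz maps\<close>

text \<open>A Lebesgue number argument: halving the radii in the cover leaves room for
  \<open>w\<close>, which may lie outside \<open>K\<close>. The sum of the finitely many constants
  dominates each of them, and the inserted 1 keeps the minimum meaningful for an empty
  cover.\<close>

lemma compact_lipschitz_near:
  assumes "compact K" and lip: "\<And>z. z \<in> K \<Longrightarrow> lipschitz_near g z"
  obtains \<delta> L where "0 < \<delta>" "0 \<le> L"
    "\<And>z w. z \<in> K \<Longrightarrow> dist z w < \<delta> \<Longrightarrow> norm (g w - g z) \<le> L * norm (w - z)"
proof -
  have "\<exists>e L. 0 < e \<and> 0 \<le> L \<and>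
      (\<forall>x\<in>ball z e. \<forall>y\<in>ball z e. norm (g x - g y) \<le> L * norm (x - y))" if "z \<in> K" for z
    using lip[OF that] by (rule lipschitz_nearE) blast
  then obtain e L where e: "\<And>z. z \<in> K \<Longrightarrow> 0 < e z" and L: "\<And>z. z \<in> K \<Longrightarrow> 0 \<le> L z"
    and eL: "\<And>z x y. z \<in> K \<Longrightarrow> x \<in> ball z (e z) \<Longrightarrow> y \<in> ball z (e z) \<Longrightarrow>
       norm (g x - g y) \<le> L z * norm (x - y)"
    by metis
  have "K \<subseteq> (\<Union>z\<in>K. ball z (e z / 2))" using e by force
  then obtain C where C: "C \<subseteq> K" "finite C" "K \<subseteq> (\<Union>z\<in>C. ball z (e z / 2))"
    using compactE_image[OF assms(1), of K "\<lambda>z. ball z (e z / 2)"] by auto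
  define \<delta> where "\<delta> = Min (insert 1 ((\<lambda>c. e c / 2) ` C))"
  have "0 < \<delta>" using C e by (auto simp: \<delta>_def)
  moreover have "0 \<le> sum L C" using C L by (intro sum_nonneg) auto
  moreover have "norm (g w - g z) \<le> sum L C * norm (w - z)" if z: "z \<in> K" and w: "dist z w < \<delta>" for z w
  proof -
    obtain c where c: "c \<in> C" "dist c z < e c / 2" using C z by auto
    have "\<delta> \<le> e c / 2" unfolding \<delta>_def using c C by (intro Min_le) auto
    then have "dist c w < e c" using c w dist_triangle_half_r[of z c "e c" w] by (simp add: dist_commute)
    moreover have "dist c z < e c" using c C e[of c] by auto
    ultimately have "norm (g w - g z) \<le> L c * norm (w - z)"
      using eL[of c w z] c C by auto
    also have "L c \<le> sum L C" using c C L by (intro member_le_sum) auto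
    finally show ?thesis by (simp add: mult_right_mono)
  qed
  ultimately show thesis by (rule that)
qed

section \<open>Difference quotients and the integral of a derivative\<close>

lemma has_derivative_difference_quotient:
  assumes g: "(g has_derivative g') (at z)" and h: "h \<longlonglongrightarrow> 0" "\<And>n. h n \<noteq> 0"
  shows "(\<lambda>n. (g (z + h n *\<^sub>R v) - g z) /\<^sub>R h n) \<longlonglongrightarrow> g' v"
proof (rule LIMSEQ_I)
  fix r :: real assume r: "0 < r"
  define \<epsilon> where "\<epsilon> = r / (2 * (norm v + 1))"
  have nv: "0 < norm v + 1" by (simp add: add_nonneg_pos)
  then have \<epsilon>: "0 < \<epsilon>" using r by (simp add: \<epsilon>_def)
  then obtain d where d: "0 < d" "\<And>y. norm (y - z) < d \<Longrightarrow> norm (g y - g z - g' (y - z)) \<le> \<epsilon> * norm (y - z)"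
    using g unfolding has_derivative_at_alt by blast
  have "(\<lambda>n. norm (h n *\<^sub>R v)) \<longlonglongrightarrow> 0"
    using h by (auto intro!: tendsto_eq_intros)
  then have "\<forall>\<^sub>F n in sequentially. norm (h n *\<^sub>R v) < d"
    using d(1) by (rule order_tendstoD)
  then obtain N where N: "\<And>n. n \<ge> N \<Longrightarrow> norm (h n *\<^sub>R v) < d"
    unfolding eventually_sequentially by blast
  have "norm ((g (z + h n *\<^sub>R v) - g z) /\<^sub>R h n - g' v) < r" if n: "n \<ge> N" for n
  proof -
    have "g' (h n *\<^sub>R v) = h n *\<^sub>R g' v"
      using g by (simp add: has_derivative_bounded_linear linear_simps)
    then have "(g (z + h n *\<^sub>R v) - g z) /\<^sub>R h n - g' v =
        (g (z + h n *\<^sub>R v) - g z - g' (h n *\<^sub>R v)) /\<^sub>R h n"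
      using h(2)[of n] by (simp add: algebra_simps)
    also have "norm \<dots> \<le> \<epsilon> * norm (h n *\<^sub>R v) / \<bar>h n\<bar>"
      using d(2)[of "z + h n *\<^sub>R v"] N[OF n] h(2)[of n] by (simp add: divide_simps mult_ac)
    also have "\<dots> = \<epsilon> * norm v" using h(2)[of n] by simp
    also have "\<dots> < \<epsilon> * (2 * (norm v + 1))"
      using \<epsilon> nv by (intro mult_strict_left_mono) (auto intro: order_le_less_trans[of _ "norm v"])
    also have "\<dots> = r" using nv by (simp add: \<epsilon>_def)
    finally show ?thesis .
  qed
  then show "\<exists>N. \<forall>n\<ge>N. norm ((g (z + h n *\<^sub>R v) - g z) /\<^sub>R h n - g' v) < r" by blast
qed

lemma has_derivative_norm_le:
  fixes g :: "'a::real_normed_vector \<Rightarrow> 'b::real_normed_vector"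
  assumes g: "(g has_derivative g') (at z)" and "0 < \<delta>"
    and L: "\<And>w. dist z w < \<delta> \<Longrightarrow> norm (g w - g z) \<le> L * norm (w - z)"
  shows "norm (g' v) \<le> L * norm v"
proof -
  \<comment> \<open>Starting at 1/2 makes every step, also that for \<open>n = 0\<close>, strictly
    shorter than \<delta>, so that the Lipschitz estimate applies along the whole sequence. The 1 in
    the denominator covers \<open>v = 0\<close>.\<close>
  define h :: "nat \<Rightarrow> real" where "h n = \<delta> / (norm v + 1) * inverse (real (Suc (Suc n)))" for n
  have nv: "0 < norm v + 1" by (simp add: add_nonneg_pos)
  have h0: "h n > 0" for n using nv \<open>0 < \<delta>\<close> by (simp add: h_def)
  have "(\<lambda>n. inverse (real (Suc (Suc n)))) \<longlonglongrightarrow> 0" 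
    using LIMSEQ_Suc[OF LIMSEQ_inverse_real_of_nat] .
  then have "h \<longlonglongrightarrow> \<delta> / (norm v + 1) * 0" unfolding h_def by (intro tendsto_intros)
  then have "(\<lambda>n. (g (z + h n *\<^sub>R v) - g z) /\<^sub>R h n) \<longlonglongrightarrow> g' v"
    using h0 by (intro has_derivative_difference_quotient[OF g]) (auto simp: less_imp_neq[symmetric])
  moreover have "norm ((g (z + h n *\<^sub>R v) - g z) /\<^sub>R h n) \<le> L * norm v" for n
  proof -
    have "h n < \<delta> / (norm v + 1) * 1"
      unfolding h_def using nv \<open>0 < \<delta>\<close> by (intro mult_strict_left_mono) (auto simp: inverse_less_1_iff)
    then have "h n * (norm v + 1) < \<delta>" using nv by (simp add: field_simps)
    then have "norm (h n *\<^sub>R v) < \<delta>" using h0[of n] by (simp add: algebra_simps)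
    then have "norm (g (z + h n *\<^sub>R v) - g z) \<le> L * (h n * norm v)"
      using L[of "z + h n *\<^sub>R v"] h0[of n] by (simp add: dist_norm)
    then show ?thesis using h0[of n] by (simp add: divide_inverse_commute[symmetric] pos_divide_le_eq mult_ac)
  qed
  ultimately show ?thesis
    by (intro LIMSEQ_le_const2[OF tendsto_norm]) auto
qed

lemma lborel_translation:
  fixes u :: "complex \<Rightarrow> complex"
  assumes "integrable lborel u"
  shows "integrable lborel (\<lambda>z. u (z + a))" "(LINT z|lborel. u (z + a)) = (LINT z|lborel. u z)"
proof -
  have [measurable]: "u \<in> borel_measurable borel" using assms by auto
  have "integrable (distr lborel borel ((+) a)) u" using assms by (simp add: lborel_distr_plus)
  then show "integrable lborel (\<lambda>z. u (z + a))"
    by (subst (asm) integrable_distr_eq) (auto simp: add.commute)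
  have "(LINT z|lborel. u z) = (LINT z|distr lborel borel ((+) a). u z)" by (simp add: lborel_distr_plus)
  also have "\<dots> = (LINT z|lborel. u (a + z))"
    by (subst integral_distr) auto
  finally show "(LINT z|lborel. u (z + a)) = (LINT z|lborel. u z)"
    by (simp add: add.commute)
qed

lemma integrable_compact_support:
  fixes u :: "complex \<Rightarrow> 'b::{banach,second_countable_topology}"
  assumes "u \<in> borel_measurable borel" "compact K" "\<And>z. norm (u z) \<le> C * indicator K z"
  shows "integrable lborel u"
proof (rule Bochner_Integration.integrable_bound)
  show "integrable lborel (\<lambda>z. C * indicator K z :: real)"
    using assms(2) by (intro integrable_mult_right integrable_real_indicator emeasure_compact_finite)
      (auto simp: compact_imp_closed borel_closed)
  show "AE x in lborel. norm (u x) \<le> norm (C * indicator K x :: real)"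
    using assms(3) by (intro AE_I2) (metis abs_ge_self order_trans real_norm_def)
qed (use assms in auto)

text \<open>Translation invariance makes the integral of every difference quotient vanish.\<close>

lemma integral_directional_derivative_eq_0:
  fixes u :: "complex \<Rightarrow> complex"
  assumes lip: "\<And>z. lipschitz_near u z" and K: "compact K" "\<And>z. z \<notin> K \<Longrightarrow> u z = 0"
    and D: "AE z in lborel. (u has_derivative u' z) (at z) \<and> u' z v = D z"
    and meas: "D \<in> borel_measurable borel"
  shows "(LINT z|lborel. D z) = 0"
proof -
  obtain R where R: "\<And>z. z \<in> K \<Longrightarrow> norm z \<le> R"
    using compact_imp_bounded[OF K(1)] unfolding bounded_iff by blast
  \<comment> \<open>A margin of 1 around the support. The steps \<open>h n *\<^sub>R v\<close> are
    kept shorter than 1, so all difference quotients vanish off \<open>K'\<close> and one multiple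
    of its indicator dominates them.\<close>
  define K' where "K' = cball (0::complex) (R + 1)"
  obtain \<delta> L where \<delta>: "0 < \<delta>" and L: "0 \<le> L"
    and \<delta>L: "\<And>z w. z \<in> K' \<Longrightarrow> dist z w < \<delta> \<Longrightarrow> norm (u w - u z) \<le> L * norm (w - z)"
    using compact_lipschitz_near[of K' u] lip unfolding K'_def by (metis compact_cball)
  have cont: "continuous_on UNIV u"
    using lip by (simp add: lipschitz_near_isCont continuous_at_imp_continuous_on)
  then have um [measurable]: "u \<in> borel_measurable borel" by (rule borel_measurable_continuous_onI)
  have "bounded (u ` K)"
    by (intro compact_imp_bounded compact_continuous_image continuous_on_subset[OF cont] K) auto
  then obtain B where B: "\<And>z. z \<in> K \<Longrightarrow> norm (u z) \<le> B" unfolding bounded_iff by blast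
  have int: "integrable lborel u"
  proof (rule integrable_compact_support[OF um K(1)])
    show "norm (u z) \<le> B * indicator K z" for z
      using B[of z] K(2)[of z] by (cases "z \<in> K") auto
  qed
  define h :: "nat \<Rightarrow> real" where "h n = min \<delta> 1 / (norm v + 1) * inverse (real (Suc (Suc n)))" for n
  have nv: "0 < norm v + 1" by (simp add: add_nonneg_pos)
  have h0: "h n > 0" for n using nv \<delta> by (simp add: h_def)
  have hb: "norm (h n *\<^sub>R v) < min \<delta> 1" for n
  proof -
    have "h n < min \<delta> 1 / (norm v + 1) * 1"
      unfolding h_def using nv \<delta> by (intro mult_strict_left_mono) (auto simp: inverse_less_1_iff)
    then have "h n * (norm v + 1) < min \<delta> 1" using nv by (simp add: field_simps)
    then show ?thesis using h0[of n] by (simp add: algebra_simps)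
  qed
  have "(\<lambda>n. inverse (real (Suc (Suc n)))) \<longlonglongrightarrow> 0" 
    using LIMSEQ_Suc[OF LIMSEQ_inverse_real_of_nat] .
  then have "h \<longlonglongrightarrow> min \<delta> 1 / (norm v + 1) * 0" unfolding h_def by (intro tendsto_intros)
  then have hlim: "h \<longlonglongrightarrow> 0" by simp
  define s where "s n z = (u (z + h n *\<^sub>R v) - u z) /\<^sub>R h n" for n z
  have "(\<lambda>n. LINT z|lborel. s n z) \<longlonglongrightarrow> (LINT z|lborel. D z)"
  proof (rule integral_dominated_convergence)
    show "integrable lborel (\<lambda>z. (L * norm v) * indicator K' z :: real)"
      unfolding K'_def by (intro integrable_mult_right integrable_real_indicator emeasure_compact_finite) auto
    show "AE z in lborel. (\<lambda>n. s n z) \<longlonglongrightarrow> D z"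
      using D
    proof eventually_elim
      case (elim z)
      then show ?case unfolding s_def
        using has_derivative_difference_quotient[of u "u' z" z h v] hlim h0
        by (metis less_irrefl)
    qed
    show "AE z in lborel. norm (s n z) \<le> (L * norm v) * indicator K' z" for n
    proof (rule AE_I2)
      fix z
      show "norm (s n z) \<le> (L * norm v) * indicator K' z"
      proof (cases "z \<in> K'")
        case True
        have "norm (u (z + h n *\<^sub>R v) - u z) \<le> L * (h n * norm v)"
          using \<delta>L[OF True, of "z + h n *\<^sub>R v"] hb[of n] h0[of n] by (simp add: dist_norm)
        then show ?thesis using True h0[of n]
          by (simp add: s_def divide_inverse_commute[symmetric] pos_divide_le_eq mult_ac)
      next
        case False
        then have "norm z > R + 1" by (simp add: K'_def)
        moreover have "norm (z + h n *\<^sub>R v) \<ge> norm z - norm (h n *\<^sub>R v)"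
          by (metis norm_diff_ineq)
        ultimately have "norm (z + h n *\<^sub>R v) > R" "norm z > R" using hb[of n] by auto
        then have "z + h n *\<^sub>R v \<notin> K" "z \<notin> K" using R by force+
        then show ?thesis using K(2) False by (simp add: s_def)
      qed
    qed
    show "D \<in> borel_measurable lborel" using meas by simp
    show "s n \<in> borel_measurable lborel" for n unfolding s_def by measurable
  qed
  moreover have "(LINT z|lborel. s n z) = 0" for n
    unfolding s_def using lborel_translation[OF int, of "h n *\<^sub>R v"] int by simp
  ultimately show ?thesis
    by (simp add: LIMSEQ_const_iff)
qed

section \<open>Products with test functions\<close>

lemma lipschitz_near_scaleR:
  fixes \<phi> :: "complex \<Rightarrow> real"
  assumes "lipschitz_near g z" "lipschitz_near (\<lambda>w. of_real (\<phi> w)) z"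
  shows "lipschitz_near (\<lambda>w. \<phi> w *\<^sub>R g w) z"
proof -
  obtain e L where e: "0 < e" "0 \<le> L"
    "\<And>x y. x \<in> ball z e \<Longrightarrow> y \<in> ball z e \<Longrightarrow> norm (g x - g y) \<le> L * norm (x - y)"
    using assms(1) by (rule lipschitz_nearE) blast
  obtain e' L' where e': "0 < e'" "0 \<le> L'"
    "\<And>x y. x \<in> ball z e' \<Longrightarrow> y \<in> ball z e' \<Longrightarrow> norm (of_real (\<phi> x) - complex_of_real (\<phi> y)) \<le> L' * norm (x - y)"
    using assms(2) by (rule lipschitz_nearE) blast
  \<comment> \<open>A radius of at most 1 lets the two Lipschitz constants also bound the values of
    the two factors.\<close>
  define d where "d = min 1 (min e e')"
  have d: "0 < d" "ball z d \<subseteq> ball z e" "ball z d \<subseteq> ball z e'" "\<And>x. x \<in> ball z d \<Longrightarrow> norm (x - z) \<le> 1"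
    using e e' by (auto simp: d_def dist_norm norm_minus_commute)
  define M where "M = norm (g z) + L"
  define M' where "M' = \<bar>\<phi> z\<bar> + L'"
  have M: "norm (g x) \<le> M" if "x \<in> ball z d" for x
  proof -
    have "norm (g x) \<le> norm (g z) + norm (g x - g z)" by (metis norm_triangle_sub)
    also have "norm (g x - g z) \<le> L * norm (x - z)" using e(1) d that by (intro e(3)) auto
    also have "\<dots> \<le> L * 1" using d(4)[OF that] e(2) by (rule mult_left_mono)
    finally show ?thesis by (simp add: M_def)
  qed
  have p: "\<bar>\<phi> x - \<phi> y\<bar> \<le> L' * norm (x - y)" if "x \<in> ball z d" "y \<in> ball z d" for x y
    using e'(3)[of x y] d that by (metis in_mono norm_of_real of_real_diff)
  have M': "\<bar>\<phi> x\<bar> \<le> M'" if "x \<in> ball z d" for x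
  proof -
    have "\<bar>\<phi> x\<bar> \<le> \<bar>\<phi> z\<bar> + \<bar>\<phi> x - \<phi> z\<bar>" by linarith
    also have "\<bar>\<phi> x - \<phi> z\<bar> \<le> L' * norm (x - z)" using d(1) that by (intro p) auto
    also have "\<dots> \<le> L' * 1" using d(4)[OF that] e'(2) by (rule mult_left_mono)
    finally show ?thesis by (simp add: M'_def)
  qed
  show ?thesis
  proof (rule lipschitz_nearI)
    fix x y assume xy: "x \<in> ball z d" "y \<in> ball z d"
    have gl: "norm (g x - g y) \<le> L * norm (x - y)"
      using xy d(2) by (intro e(3)) blast+
    have "\<phi> x *\<^sub>R g x - \<phi> y *\<^sub>R g y = \<phi> x *\<^sub>R (g x - g y) + (\<phi> x - \<phi> y) *\<^sub>R g y"
      by (simp add: algebra_simps)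
    then have "norm (\<phi> x *\<^sub>R g x - \<phi> y *\<^sub>R g y) \<le> \<bar>\<phi> x\<bar> * norm (g x - g y) + \<bar>\<phi> x - \<phi> y\<bar> * norm (g y)"
      by (metis norm_scaleR norm_triangle_ineq)
    also have "\<dots> \<le> M' * (L * norm (x - y)) + (L' * norm (x - y)) * M"
      using M'[OF xy(1)] M[OF xy(2)] p[OF xy] gl e(2) e'(2)
      by (intro add_mono mult_mono) (auto simp: M'_def)
    also have "\<dots> = (M' * L + L' * M) * norm (x - y)" by (simp add: algebra_simps)
    finally show "norm (\<phi> x *\<^sub>R g x - \<phi> y *\<^sub>R g y) \<le> (M' * L + L' * M) * norm (x - y)" .
  qed (use d in auto)
qed

lemma cont_diff_continuous_partial:
  assumes "\<And>n. cont_diff n \<phi>"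
  shows "continuous_on UNIV (\<lambda>z. frechet_derivative \<phi> (at z) v)"
proof -
  have "cont_diff (Suc 0) (\<lambda>z. frechet_derivative \<phi> (at z) v)"
    using assms[of "Suc (Suc 0)"] by simp
  then show ?thesis
    by (auto intro!: continuous_at_imp_continuous_on differentiable_imp_continuous_within)
qed

lemma cont_diff_has_derivative:
  assumes "\<And>n. cont_diff n \<phi>"
  shows "(\<phi> has_derivative frechet_derivative \<phi> (at z)) (at z)"
  using assms[of "Suc 0"] by (simp add: frechet_derivative_works[symmetric])

text \<open>The definition of \<open>cont_diff\<close> controls derivatives in one fixed direction
  at a time. By linearity the directions 1 and \<i> bound the operator norm, and then the mean value
  inequality applies.\<close>

lemma cont_diff_lipschitz_near:
  assumes cd: "\<And>n. cont_diff n \<phi>"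
  shows "lipschitz_near (\<lambda>w. of_real (\<phi> w)) z"
proof -
  let ?d = "\<lambda>v w. frechet_derivative \<phi> (at w) v"
  have "\<exists>B. \<forall>w\<in>cball z 1. \<bar>?d v w\<bar> \<le> B" for v
  proof -
    have "bounded (?d v ` cball z 1)"
      using cont_diff_continuous_partial[OF cd, of v]
      by (intro compact_imp_bounded compact_continuous_image) (auto intro: continuous_on_subset)
    then show ?thesis by (auto simp: bounded_iff)
  qed
  then obtain B where B: "\<And>v w. w \<in> cball z 1 \<Longrightarrow> \<bar>?d v w\<bar> \<le> B v" by metis
  show ?thesis
  proof (rule lipschitz_nearI)
    fix x y assume xy: "x \<in> ball z 1" "y \<in> ball z 1"
    have "norm (\<phi> x - \<phi> y) \<le> (B 1 + B \<i>) * norm (x - y)"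
    proof (rule differentiable_bound[of "ball z 1" \<phi> "\<lambda>w. frechet_derivative \<phi> (at w)"])
      fix w assume w: "w \<in> ball z 1"
      have der: "(\<phi> has_derivative frechet_derivative \<phi> (at w)) (at w)"
        using cd by (rule cont_diff_has_derivative)
      then show "(\<phi> has_derivative frechet_derivative \<phi> (at w)) (at w within ball z 1)"
        by (rule has_derivative_at_withinI)
      have lin: "linear (frechet_derivative \<phi> (at w))"
        using der by (rule has_derivative_linear)
      show "onorm (frechet_derivative \<phi> (at w)) \<le> B 1 + B \<i>"
      proof (rule onorm_le)
        fix v :: complex
        have "v = Re v *\<^sub>R 1 + Im v *\<^sub>R \<i>" by (simp add: complex_eq_iff)
        then have "?d v w = Re v * ?d 1 w + Im v * ?d \<i> w"
          using linear_add[OF lin] linear_scale[OF lin] by (metis real_scaleR_def)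
        then have "\<bar>?d v w\<bar> \<le> \<bar>Re v\<bar> * \<bar>?d 1 w\<bar> + \<bar>Im v\<bar> * \<bar>?d \<i> w\<bar>"
          by (metis abs_mult abs_triangle_ineq)
        also have "\<dots> \<le> norm v * B 1 + norm v * B \<i>"
          using B[of w] w abs_Re_le_cmod abs_Im_le_cmod by (intro add_mono mult_mono) auto
        finally show "norm (?d v w) \<le> (B 1 + B \<i>) * norm v" by (simp add: algebra_simps)
      qed
    qed (use xy in auto)
    then show "norm (of_real (\<phi> x) - complex_of_real (\<phi> y)) \<le> (B 1 + B \<i>) * norm (x - y)"
      by (metis norm_of_real of_real_diff real_norm_def)
  qed auto
qed

text \<open>The common setting for the four chart expressions, with the unit circle as
  \<open>E\<close>. Closedness of \<open>E\<close> makes \<open>\<Omega> - E\<close> open, hence its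
  indicator Borel; nullity lets the classical derivative off \<open>E\<close> serve as the weak
  one.\<close>

locale locally_lipschitz_map =
  fixes \<Omega> E :: "complex set" and g :: "complex \<Rightarrow> complex"
  assumes open_\<Omega>: "open \<Omega>" and closed_E: "closed E" and null_E: "E \<in> null_sets lborel"
    and lip: "\<And>z. z \<in> \<Omega> \<Longrightarrow> lipschitz_near g z"
    and diff: "\<And>z. z \<in> \<Omega> \<Longrightarrow> z \<notin> E \<Longrightarrow> g differentiable (at z)"
begin

text \<open>Cut off to a Borel function on the whole plane, so that set integrals over \<Omega> with
  respect to \<open>lebesgue\<close> can be replaced by integrals over the plane with respect to
  \<open>lborel\<close>.\<close>

definition partial :: "complex \<Rightarrow> complex \<Rightarrow> complex" where
  "partial v z = indicator (\<Omega> - E) z *\<^sub>R frechet_derivative g (at z) v"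

lemma has_deriv: "z \<in> \<Omega> \<Longrightarrow> z \<notin> E \<Longrightarrow> (g has_derivative (\<lambda>v. partial v z)) (at z)"
  using diff[of z] by (simp add: partial_def frechet_derivative_works[symmetric])

lemma cont: "continuous_on \<Omega> g"
  using lip by (simp add: lipschitz_near_isCont continuous_at_imp_continuous_on)

lemma ext_measurable [measurable]: "(\<lambda>z. indicator \<Omega> z *\<^sub>R g z) \<in> borel_measurable borel"
  using open_\<Omega> cont by (intro borel_measurable_continuous_on_indicator) auto

text \<open>A pointwise limit of Borel difference quotients. They are formed with the zero extension
  \<open>G\<close> because \<open>z + h n *\<^sub>R v\<close> may lie outside \<Omega> for small
  \<open>n\<close>.\<close>

lemma partial_measurable [measurable]: "partial v \<in> borel_measurable borel"
proof -
  define G where "G z = indicator \<Omega> z *\<^sub>R g z" for z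
  define h where "h n = inverse (real (Suc n))" for n
  have [measurable]: "G \<in> borel_measurable borel" unfolding G_def by measurable
  have S: "open (\<Omega> - E)" using open_\<Omega> closed_E by blast
  then have [measurable]: "\<Omega> - E \<in> sets borel" by simp
  show ?thesis
  proof (rule borel_measurable_LIMSEQ_metric)
    show "(\<lambda>z. indicator (\<Omega> - E) z *\<^sub>R ((G (z + h n *\<^sub>R v) - G z) /\<^sub>R h n)) \<in> borel_measurable borel" for n
      by measurable
    show "(\<lambda>n. indicator (\<Omega> - E) z *\<^sub>R ((G (z + h n *\<^sub>R v) - G z) /\<^sub>R h n)) \<longlonglongrightarrow> partial v z" for z
    proof (cases "z \<in> \<Omega> - E")
      case True
      have "(G has_derivative (\<lambda>v. partial v z)) (at z)"
        by (rule has_derivative_transform_within_open[OF has_deriv open_\<Omega>]) (use True in \<open>auto simp: G_def\<close>)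
      then have "(\<lambda>n. (G (z + h n *\<^sub>R v) - G z) /\<^sub>R h n) \<longlonglongrightarrow> partial v z"
        by (rule has_derivative_difference_quotient)
          (use LIMSEQ_inverse_real_of_nat in \<open>auto simp: h_def\<close>)
      then show ?thesis using True by simp
    qed (simp add: partial_def)
  qed
qed

text \<open>A derivative is bounded by a local Lipschitz constant, which can be chosen uniformly on
  \<open>K\<close>; on \<open>E\<close> the value is 0.\<close>

lemma partial_bounded:
  assumes "compact K" "K \<subseteq> \<Omega>"
  obtains B where "\<And>z. z \<in> K \<Longrightarrow> norm (partial v z) \<le> B"
proof -
  obtain \<delta> L where \<delta>: "0 < \<delta>" "0 \<le> L" 
    "\<And>z w. z \<in> K \<Longrightarrow> dist z w < \<delta> \<Longrightarrow> norm (g w - g z) \<le> L * norm (w - z)"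
    using compact_lipschitz_near[of K g] assms lip by (metis subsetD)
  have "norm (partial v z) \<le> L * norm v" if z: "z \<in> K" for z
  proof (cases "z \<in> E")
    case True
    then show ?thesis using \<delta> by (simp add: partial_def)
  next
    case False
    then show ?thesis
      using has_derivative_norm_le[OF has_deriv \<delta>(1) \<delta>(3)[OF z]] z assms by blast
  qed
  then show thesis by (rule that)
qed

lemma g_bounded:
  assumes "compact K" "K \<subseteq> \<Omega>"
  obtains B where "\<And>z. z \<in> K \<Longrightarrow> norm (g z) \<le> B"
proof -
  have "bounded (g ` K)"
    by (intro compact_imp_bounded compact_continuous_image continuous_on_subset[OF cont] assms)
  then show thesis using that unfolding bounded_iff by blast
qed

lemma L2_locI:
  assumes meas: "(\<lambda>z. indicator \<Omega> z *\<^sub>R f z) \<in> borel_measurable borel"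
    and bd: "\<And>K. compact K \<Longrightarrow> K \<subseteq> \<Omega> \<Longrightarrow> \<exists>B. \<forall>z\<in>K. norm (f z) \<le> B"
  shows "L2_loc \<Omega> f"
  unfolding L2_loc_def
proof (intro conjI allI impI)
  show "set_borel_measurable lebesgue \<Omega> f"
    unfolding set_borel_measurable_def using meas by (intro measurable_completion) simp
  fix K assume K: "compact K \<and> K \<subseteq> \<Omega>"
  then have "\<exists>B. \<forall>z\<in>K. norm (f z) \<le> B" by (intro bd) auto
  then obtain B where B: "\<And>z. z \<in> K \<Longrightarrow> norm (f z) \<le> B" by blast
  \<comment> \<open>The second indicator changes nothing, since \<open>K\<close> lies in \<Omega>,
    but it brings in the Borel function of the hypothesis; nothing is known of \<open>f\<close> off
    \<Omega>.\<close>
  define F where "F z = indicator K z * (norm (indicator \<Omega> z *\<^sub>R f z))^2" for z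
  have [measurable]: "K \<in> sets borel" using K by (simp add: compact_imp_closed borel_closed)
  have Fm: "F \<in> borel_measurable borel" unfolding F_def using meas by measurable
  have "integrable lborel F"
  proof (rule integrable_compact_support[OF Fm])
    show "norm (F z) \<le> B^2 * indicator K z" for z
      using B[of z] by (cases "z \<in> K") (auto simp: F_def power_mono indicator_def)
  qed (use K in auto)
  then have "integrable lebesgue F"
    using Fm by (subst integrable_completion) auto
  moreover have "F = (\<lambda>z. indicator K z *\<^sub>R (norm (f z))^2)"
    using K by (auto simp: F_def indicator_def fun_eq_iff)
  ultimately show "set_integrable lebesgue K (\<lambda>z. (norm (f z))\<^sup>2)"
    unfolding set_integrable_def by simp
qed

lemma L2_g: "L2_loc \<Omega> g"
  by (rule L2_locI[OF ext_measurable]) (metis g_bounded)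

lemma indicator_partial: "indicator \<Omega> z *\<^sub>R partial v z = partial v z"
  by (auto simp: partial_def indicator_def)

lemma L2_partial: "L2_loc \<Omega> (partial v)"
  by (rule L2_locI) (simp add: indicator_partial, metis partial_bounded)

text \<open>The product of the test function with \<open>g\<close>, extended by 0, is locally
  Lipschitz on the plane and vanishes off a compact set, so the integral of its derivative along
  \<open>v\<close> is 0. By the product rule this derivative is almost everywhere the sum
  \<open>A + B\<close> of the two integrands.\<close>

lemma weak_derivative_partial: "weak_derivative \<Omega> v g (partial v)"
  unfolding weak_derivative_def
proof
  fix \<phi> assume "\<phi> \<in> test_functions \<Omega>"
  then obtain K where cd: "\<And>n. cont_diff n \<phi>" and K: "compact K" "K \<subseteq> \<Omega>" 
    and \<phi>0: "\<And>z. z \<notin> K \<Longrightarrow> \<phi> z = 0"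
    unfolding test_functions_def by blast
  define \<psi> where "\<psi> z = frechet_derivative \<phi> (at z) v" for z
  define G where "G z = indicator \<Omega> z *\<^sub>R g z" for z
  define A where "A z = \<psi> z *\<^sub>R G z" for z
  define B where "B z = \<phi> z *\<^sub>R partial v z" for z
  define u where "u z = \<phi> z *\<^sub>R G z" for z
  have \<phi>d: "(\<phi> has_derivative frechet_derivative \<phi> (at z)) (at z)" for z
    using cd by (rule cont_diff_has_derivative)
  have opK: "open (- K)" using K by (simp add: compact_imp_closed open_Compl)
  have \<psi>0: "frechet_derivative \<phi> (at z) w = 0" if "z \<notin> K" for z w
  proof -
    have "((\<lambda>_. 0) has_derivative frechet_derivative \<phi> (at z)) (at z)"
      by (rule has_derivative_transform_within_open[OF \<phi>d opK]) (use that \<phi>0 in auto)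
    then show ?thesis using frechet_derivative_at[of "\<lambda>_. 0::real"] has_derivative_const
      by (metis has_derivative_unique)
  qed
  have \<psi>c: "continuous_on UNIV \<psi>"
    unfolding \<psi>_def using cd by (rule cont_diff_continuous_partial)
  have \<phi>c: "continuous_on UNIV \<phi>" using cd[of 0] by simp
  have [measurable]: "\<psi> \<in> borel_measurable borel" "\<phi> \<in> borel_measurable borel"
    using \<psi>c \<phi>c by (auto intro: borel_measurable_continuous_onI)
  have [measurable]: "G \<in> borel_measurable borel" unfolding G_def by measurable
  have Am: "A \<in> borel_measurable borel" and Bm: "B \<in> borel_measurable borel"
    unfolding A_def B_def by measurable
  have bd: "\<exists>C. \<forall>z\<in>K. norm (f z) \<le> C" if "continuous_on UNIV f" for f :: "complex \<Rightarrow> real"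
  proof -
    have "bounded (f ` K)"
      using that K by (intro compact_imp_bounded compact_continuous_image) (auto intro: continuous_on_subset)
    then show ?thesis unfolding bounded_iff by blast
  qed
  obtain C1 where C1: "\<And>z. z \<in> K \<Longrightarrow> \<bar>\<psi> z\<bar> \<le> C1" using bd[OF \<psi>c] by auto
  obtain C2 where C2: "\<And>z. z \<in> K \<Longrightarrow> \<bar>\<phi> z\<bar> \<le> C2" using bd[OF \<phi>c] by auto
  obtain C3 where C3: "\<And>z. z \<in> K \<Longrightarrow> norm (g z) \<le> C3" using K by (rule g_bounded) blast
  obtain C4 where C4: "\<And>z. z \<in> K \<Longrightarrow> norm (partial v z) \<le> C4" using K by (rule partial_bounded) blast
  have intA: "integrable lborel A"
  proof (rule integrable_compact_support[OF Am K(1)])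
    fix z show "norm (A z) \<le> (C1 * C3) * indicator K z"
    proof (cases "z \<in> K")
      case True
      then have "\<bar>\<psi> z\<bar> * norm (g z) \<le> C1 * C3"
        using C1[OF True] C3[OF True] by (intro mult_mono) auto
      then show ?thesis using True K by (auto simp: A_def G_def)
    qed (use \<psi>0 in \<open>auto simp: A_def \<psi>_def\<close>)
  qed
  have intB: "integrable lborel B"
  proof (rule integrable_compact_support[OF Bm K(1)])
    fix z show "norm (B z) \<le> (C2 * C4) * indicator K z"
    proof (cases "z \<in> K")
      case True
      then have "\<bar>\<phi> z\<bar> * norm (partial v z) \<le> C2 * C4"
        using C2[OF True] C4[OF True] by (intro mult_mono) auto
      then show ?thesis using True K by (auto simp: B_def)
    qed (use \<phi>0 in \<open>auto simp: B_def\<close>)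
  qed
  have "(LINT z|lborel. A z + B z) = 0"
  proof (rule integral_directional_derivative_eq_0[of u K])
    show "lipschitz_near u z" for z
    proof (cases "z \<in> \<Omega>")
      case True
      have "lipschitz_near (\<lambda>w. \<phi> w *\<^sub>R g w) z"
        using lip[OF True] cont_diff_lipschitz_near[OF cd] by (rule lipschitz_near_scaleR)
      then obtain e L where e: "0 < e" "0 \<le> L" "\<And>x y. x \<in> ball z e \<Longrightarrow> y \<in> ball z e \<Longrightarrow>
          norm (\<phi> x *\<^sub>R g x - \<phi> y *\<^sub>R g y) \<le> L * norm (x - y)"
        by (rule lipschitz_nearE) blast
      obtain d where d: "0 < d" "ball z d \<subseteq> \<Omega>" using open_\<Omega> True open_contains_ball by blast
      show ?thesis
        by (rule lipschitz_nearI[of z "min d e" _ L])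
          (use d e in \<open>auto simp: u_def G_def subset_iff\<close>)
    next
      \<comment> \<open>The complement of \<open>K\<close> is a neighbourhood of such a point and
        \<open>u\<close> vanishes on it, so the zero extension creates no singularity on the
        boundary of \<Omega>.\<close>
      case False
      then have "z \<in> - K" using K by auto
      then obtain d where d: "0 < d" "ball z d \<subseteq> - K" using opK open_contains_ball by blast
      then have "u x = 0" if "x \<in> ball z d" for x using that \<phi>0 by (auto simp: u_def)
      then show ?thesis using d(1) by (intro lipschitz_nearI[of z d _ 0]) auto
    qed
    show "u z = 0" if "z \<notin> K" for z using that \<phi>0 by (simp add: u_def)
    define u' where "u' z w = frechet_derivative \<phi> (at z) w *\<^sub>R G z + \<phi> z *\<^sub>R partial w z" for z w
    have "(u has_derivative u' z) (at z) \<and> u' z v = A z + B z" if "z \<notin> E" for z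
    proof 
      show "u' z v = A z + B z" by (simp add: u'_def A_def B_def \<psi>_def)
      show "(u has_derivative u' z) (at z)"
      proof (cases "z \<in> \<Omega>")
        case True
        have "(G has_derivative (\<lambda>v. partial v z)) (at z)"
          by (rule has_derivative_transform_within_open[OF has_deriv open_\<Omega>]) 
             (use True that in \<open>auto simp: G_def\<close>)
        then show ?thesis unfolding u_def u'_def
          using has_derivative_scaleR[OF \<phi>d] by (simp add: add.commute)
      next
        case False
        then have z: "z \<notin> K" using K by auto
        then have "u' z = (\<lambda>_. 0)" using \<phi>0 \<psi>0 by (auto simp: u'_def)
        moreover have "(u has_derivative (\<lambda>_. 0)) (at z)"
          by (rule has_derivative_transform_within_open[OF has_derivative_const opK]) 
             (use z \<phi>0 in \<open>auto simp: u_def\<close>)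
        ultimately show ?thesis by simp
      qed
    qed
    then show "AE z in lborel. (u has_derivative u' z) (at z) \<and> u' z v = A z + B z"
      using AE_not_in[OF null_E] by (auto elim: eventually_mono)
    show "(\<lambda>z. A z + B z) \<in> borel_measurable borel" using Am Bm by measurable
  qed (rule K(1))
  then have "(LINT z|lborel. A z) = - (LINT z|lborel. B z)"
    using intA intB by (simp add: eq_neg_iff_add_eq_0)
  moreover have "(LINT z:\<Omega>|lebesgue. frechet_derivative \<phi> (at z) v *\<^sub>R g z) = (LINT z|lborel. A z)"
  proof -
    have "(LINT z:\<Omega>|lebesgue. frechet_derivative \<phi> (at z) v *\<^sub>R g z) = (LINT z|lebesgue. A z)"
      unfolding set_lebesgue_integral_def A_def G_def \<psi>_def by (simp add: mult.commute)
    then show ?thesis using integral_completion[of A lborel] Am by simp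
  qed
  moreover have "(LINT z:\<Omega>|lebesgue. \<phi> z *\<^sub>R partial v z) = (LINT z|lborel. B z)"
  proof -
    have "indicator \<Omega> z *\<^sub>R \<phi> z *\<^sub>R partial v z = B z" for z
      by (auto simp: B_def partial_def indicator_def)
    then have "(LINT z:\<Omega>|lebesgue. \<phi> z *\<^sub>R partial v z) = (LINT z|lebesgue. B z)"
      unfolding set_lebesgue_integral_def by simp
    then show ?thesis using integral_completion[of B lborel] Bm by simp
  qed
  ultimately show "(LINT z:\<Omega>|lebesgue. frechet_derivative \<phi> (at z) v *\<^sub>R g z) =
    - (LINT z:\<Omega>|lebesgue. \<phi> z *\<^sub>R partial v z)" by simp
qed

lemma W12_loc_partial: "W12_loc_partials \<Omega> g (partial 1) (partial \<i>)"
  unfolding W12_loc_partials_def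
  using L2_g L2_partial weak_derivative_partial by blast

end

lemma qc_at_imp_local_quasiconformal:
  assumes \<Omega>: "open \<Omega>" and E: "closed E" "E \<in> null_sets lborel"
    and qc: "\<And>z. z \<in> \<Omega> \<Longrightarrow> qc_at k E g z"
  shows "sense_preserving_on \<Omega> g" "dilatation_bound_on k \<Omega> g"
proof -
  interpret locally_lipschitz_map \<Omega> E g
  proof
    show "g differentiable (at z)" if "z \<in> \<Omega>" "z \<notin> E" for z
      using qc[OF that(1)] that(2) unfolding qc_at_def dilatation_at_def
      by (auto simp: differentiable_def)
  qed (use assms in \<open>auto simp: qc_at_def\<close>)
  show "sense_preserving_on \<Omega> g"
    unfolding sense_preserving_on_def
  proof
    fix z assume z: "z \<in> \<Omega>"
    then have "near_linear g z" using qc by (simp add: qc_at_def)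
    then show "\<forall>\<^sub>F r in at_right 0. winding_number (g \<circ> circlepath z r) (g z) = 1"
      using open_\<Omega> z cont by (rule near_linear_winding_number)
  qed
  have "norm ((partial 1 z + \<i> * partial \<i> z) / 2) \<le> k * norm ((partial 1 z - \<i> * partial \<i> z) / 2)"
    if z: "z \<in> \<Omega>" "z \<notin> E" for z
  proof -
    obtain p q where p: "(g has_derivative (\<lambda>v. p * v + q * cnj v)) (at z)" "norm q \<le> k * norm p"
      using qc[OF z(1)] z(2) unfolding qc_at_def dilatation_at_def by blast
    have "partial v z = p * v + q * cnj v" for v
      using has_derivative_unique[OF has_deriv[OF z] p(1)] by meson
    \<comment> \<open>The values of \<open>p * v + q * cnj v\<close> at \<open>v = 1\<close> and
      \<open>v = \<i>\<close>. Half their sum is \<open>q\<close> and half their difference is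
      \<open>p\<close>, as the dilatation bound requires.\<close>
    then have "partial 1 z = p + q" "\<i> * partial \<i> z = q - p" 
      by (auto simp: right_diff_distrib mult.left_commute[of \<i>])
    then have "(partial 1 z + \<i> * partial \<i> z) / 2 = q" "(partial 1 z - \<i> * partial \<i> z) / 2 = p"
      by auto
    then show ?thesis using p(2) by simp
  qed
  moreover have "AE z in lebesgue. z \<notin> E"
    using AE_not_in[OF E(2)] by (rule AE_completion)
  ultimately have "AE z in lebesgue. z \<in> \<Omega> \<longrightarrow>
      norm ((partial 1 z + \<i> * partial \<i> z) / 2) \<le> k * norm ((partial 1 z - \<i> * partial \<i> z) / 2)"
    by (auto elim: eventually_mono)
  then show "dilatation_bound_on k \<Omega> g"
    unfolding dilatation_bound_on_def using W12_loc_partial by blast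
qed

subsection \<open>Homeomorphisms of the sphere\<close>

lemma topspace_riemann_sphere [simp]: "topspace riemann_sphere = UNIV"
  by (auto simp: riemann_sphere_def) (metis not_None_eq rangeI)

lemma openin_riemann_sphere:
  "openin riemann_sphere U \<longleftrightarrow>
     (\<exists>V. open V \<and> U = Some ` V) \<or> (\<exists>C. compact C \<and> U = insert None (Some ` (- C)))"
  unfolding riemann_sphere_def openin_Alexandroff_compactification
  by (auto simp: Compl_eq_Diff_UNIV compact_imp_closed)

lemma continuous_map_riemann_sphere:
  assumes open_pre: "\<And>V. open V \<Longrightarrow> openin riemann_sphere (F -` Some ` V)"
    and compact_pre: "\<And>C. compact C \<Longrightarrow> openin riemann_sphere (F -` insert None (Some ` (- C)))"
  shows "continuous_map riemann_sphere riemann_sphere F"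
  unfolding continuous_map_def
proof (intro conjI allI impI)
  fix U assume "openin riemann_sphere U"
  then have "openin riemann_sphere (F -` U)"
    unfolding openin_riemann_sphere[of U] using assms by blast
  then show "openin riemann_sphere {x \<in> topspace riemann_sphere. F x \<in> U}"
    by (simp add: vimage_def)
qed simp

text \<open>Properness is continuity at \<open>None\<close>, whose open neighbourhoods are the
  complements of compact sets.\<close>

lemma continuous_map_map_option_riemann_sphere:
  assumes cont: "continuous_on UNIV g" and proper: "\<And>C. compact C \<Longrightarrow> compact (g -` C)"
  shows "continuous_map riemann_sphere riemann_sphere (map_option g)"
proof (rule continuous_map_riemann_sphere)
  fix V :: "complex set" assume V: "open V"
  have "map_option g -` Some ` V = Some ` (g -` V)" by (force simp: map_option_case split: option.splits)
  then show "openin riemann_sphere (map_option g -` Some ` V)"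
    using open_vimage[OF V cont] by (auto simp: openin_riemann_sphere)
next
  fix C :: "complex set" assume C: "compact C"
  have "map_option g -` insert None (Some ` (- C)) = insert None (Some ` (- (g -` C)))"
    by (force simp: map_option_case split: option.splits)
  then show "openin riemann_sphere (map_option g -` insert None (Some ` (- C)))"
    using proper[OF C] by (auto simp: openin_riemann_sphere)
qed

lemma homeomorphic_map_map_option_riemann_sphere:
  assumes "homeomorphism UNIV UNIV g g'"
  shows "homeomorphic_map riemann_sphere riemann_sphere (map_option g)"
proof -
  have g: "\<And>x. g' (g x) = x" "\<And>x. g (g' x) = x" "continuous_on UNIV g" "continuous_on UNIV g'"
    using assms by (auto simp: homeomorphism_def)
  \<comment> \<open>Preimages under one map are images under its inverse, which makes both maps
    proper.\<close>
  have "g -` C = g' ` C" "g' -` C = g ` C" for C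
    using g(1,2) by (auto intro: rev_image_eqI)
  then have "compact (g -` C)" "compact (g' -` C)" if "compact C" for C
    using that g by (auto intro!: compact_continuous_image intro: continuous_on_subset)
  then have "continuous_map riemann_sphere riemann_sphere (map_option g)"
    "continuous_map riemann_sphere riemann_sphere (map_option g')"
    using g by (auto intro!: continuous_map_map_option_riemann_sphere)
  then have "homeomorphic_maps riemann_sphere riemann_sphere (map_option g) (map_option g')"
    using g by (auto simp: homeomorphic_maps_def option.map_comp o_def option.map_ident)
  then show ?thesis by (rule homeomorphic_maps_imp_map)
qed

section \<open>The inversion of the sphere\<close>

lemma sphere_inv_sphere_inv [simp]: "sphere_inv (sphere_inv p) = p"
  by (cases p) (auto simp: sphere_inv_def)

lemma sphere_inv_simps [simp]:
  "sphere_inv None = Some 0" "sphere_inv (Some 0) = None" "z \<noteq> 0 \<Longrightarrow> sphere_inv (Some z) = Some (1 / z)"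
  by (auto simp: sphere_inv_def)

lemma open_inverse_vimage:
  assumes "open (V :: complex set)"
  shows "open {z. z \<noteq> 0 \<and> 1 / z \<in> V}"
proof -
  have "open ((\<lambda>z. 1 / z) -` V \<inter> (- {0}))"
    using assms by (subst Int_commute, intro continuous_open_preimage continuous_intros open_Compl) auto
  moreover have "(\<lambda>z. 1 / z) -` V \<inter> (- {0}) = {z. z \<noteq> 0 \<and> 1 / z \<in> V}" by auto
  ultimately show ?thesis by simp
qed

text \<open>Whether 0 belongs to \<open>V\<close> or to \<open>C\<close> decides whether the
  preimage contains \<open>None\<close>, and so which of the two kinds of open set it has to
  be.\<close>

lemma continuous_map_sphere_inv: "continuous_map riemann_sphere riemann_sphere sphere_inv"
proof (rule continuous_map_riemann_sphere)
  fix V :: "complex set" assume V: "open V"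
  define V' where "V' = {z. z \<noteq> 0 \<and> 1 / z \<in> V}"
  have V': "open V'" unfolding V'_def using V by (rule open_inverse_vimage)
  have S: "Some z \<in> sphere_inv -` Some ` V \<longleftrightarrow> z \<in> V'" for z
    by (cases "z = 0") (auto simp: V'_def)
  show "openin riemann_sphere (sphere_inv -` Some ` V)"
  proof (cases "0 \<in> V")
    case False
    then have "None \<notin> sphere_inv -` Some ` V" by auto
    then have "sphere_inv -` Some ` V = Some ` V'"
      using S by (intro set_eqI) (metis imageE imageI not_None_eq option.inject)
    then show ?thesis using V' by (auto simp: openin_riemann_sphere)
  next
    case True
    then have "None \<in> sphere_inv -` Some ` V" by auto
    then have eq: "sphere_inv -` Some ` V = insert None (Some ` (- (- V')))"
      using S by (intro set_eqI) (metis double_complement imageE imageI insert_iff not_None_eq option.inject)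
    \<comment> \<open>Inversion carries the exterior of a large disc into this small one, so the
      complement of \<open>V'\<close> is bounded.\<close>
    obtain e where e: "e > 0" "ball 0 e \<subseteq> V" using V True open_contains_ball by blast
    have "norm z \<le> 1 / e" if "z \<in> - V'" for z
    proof (rule ccontr)
      assume n: "\<not> norm z \<le> 1 / e"
      then have "norm z > 1 / e" "norm z > 0" using e(1) by (auto intro: less_trans[of 0 "1/e"])
      then have "norm (1 / z) < e" using e(1) by (simp add: norm_divide field_simps)
      then have "z \<in> V'" using e \<open>norm z > 0\<close> by (auto simp: V'_def)
      with that show False by simp
    qed
    then have "bounded (- V')" unfolding bounded_iff by blast
    then have "compact (- V')" using V' by (simp add: compact_eq_bounded_closed closed_Compl)
    then show ?thesis unfolding openin_riemann_sphere using eq by blast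
  qed
next
  fix C :: "complex set" assume C: "compact C"
  define W where "W = insert 0 {z. z \<noteq> 0 \<and> 1 / z \<in> - C}"
  have S: "Some z \<in> sphere_inv -` insert None (Some ` (- C)) \<longleftrightarrow> z \<in> W" for z
    by (cases "z = 0") (auto simp: W_def)
  show "openin riemann_sphere (sphere_inv -` insert None (Some ` (- C)))"
  proof (cases "0 \<in> C")
    case True
    then have "None \<notin> sphere_inv -` insert None (Some ` (- C))" by auto
    then have eq: "sphere_inv -` insert None (Some ` (- C)) = Some ` W"
      using S by (intro set_eqI) (metis imageE imageI not_None_eq option.inject)
    \<comment> \<open>The bound on \<open>C\<close> puts a whole disc of radius 1/R about 0 into
      \<open>W\<close>, which is then open at the added point 0 too.\<close>
    obtain R where R: "R > 0" "\<And>z. z \<in> C \<Longrightarrow> norm z \<le> R"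
      using compact_imp_bounded[OF C] bounded_pos by metis
    have "W = ball 0 (1 / R) \<union> {z. z \<noteq> 0 \<and> 1 / z \<in> - C}"
    proof -
      have "1 / z \<notin> C" if "norm z < 1 / R" "z \<noteq> 0" for z
      proof
        assume "1 / z \<in> C"
        from R(2)[OF this] that R(1) show False by (simp add: norm_divide field_simps)
      qed
      then show ?thesis using R(1) by (auto simp: W_def)
    qed
    moreover have "open {z. z \<noteq> 0 \<and> 1 / z \<in> - C}"
      using C by (intro open_inverse_vimage open_Compl compact_imp_closed)
    ultimately have "open W" by auto
    then show ?thesis unfolding openin_riemann_sphere using eq by blast
  next
    case False
    then have "None \<in> sphere_inv -` insert None (Some ` (- C))" by auto
    then have eq: "sphere_inv -` insert None (Some ` (- C)) = insert None (Some ` (- (- W)))"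
      using S by (intro set_eqI) (metis double_complement imageE imageI insert_iff not_None_eq option.inject)
    have "- W = (\<lambda>z. 1 / z) ` C"
      using False by (auto simp: W_def intro: rev_image_eqI)
    moreover have "compact ((\<lambda>z. 1 / z) ` C)"
      using C False by (intro compact_continuous_image continuous_intros) auto
    ultimately have "compact (- W)" by simp
    then show ?thesis unfolding openin_riemann_sphere using eq by blast
  qed
qed

lemma homeomorphic_map_sphere_inv: "homeomorphic_map riemann_sphere riemann_sphere sphere_inv"
proof -
  have "homeomorphic_maps riemann_sphere riemann_sphere sphere_inv sphere_inv"
    by (simp add: homeomorphic_maps_def continuous_map_sphere_inv)
  then show ?thesis by (rule homeomorphic_maps_imp_map)
qed

lemma continuous_map_Some_riemann_sphere: "continuous_map euclidean riemann_sphere Some"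
  unfolding riemann_sphere_def by (rule continuous_map_Some)

text \<open>Turns continuity of a map at \<open>None\<close> into a limit along finite points, the
  sense in which the explicit formula is read at infinity.\<close>

lemma limitin_Some_at_infinity: "limitin riemann_sphere Some None at_infinity"
  unfolding limitin_def
proof (intro conjI allI impI)
  fix U assume "openin riemann_sphere U \<and> None \<in> U"
  then obtain C where C: "compact C" "U = insert None (Some ` (- C))"
    by (auto simp: openin_riemann_sphere)
  obtain R where R: "\<And>z. z \<in> C \<Longrightarrow> norm z \<le> R"
    using compact_imp_bounded[OF C(1)] unfolding bounded_iff by blast
  have "\<forall>z. norm z \<ge> R + 1 \<longrightarrow> Some z \<in> U"
    using R by (force simp: C(2))
  then show "\<forall>\<^sub>F z in at_infinity. Some z \<in> U"
    unfolding eventually_at_infinity by blast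
qed simp

subsection \<open>Lipschitz perturbations of the identity\<close>

text \<open>In the coordinate z = 1/w this is the identity on the open unit disc and the reflection
  z \<mapsto> 1/cnj z in the unit circle outside it: it folds the sphere onto the closed
  disc.\<close>

definition reflect_disc :: "complex \<Rightarrow> complex" where
  "reflect_disc w = (if norm w \<le> 1 then cnj w else 1 / w)"

lemma reflect_disc_mem: "reflect_disc w \<in> cball 0 1"
  by (auto simp: reflect_disc_def norm_divide divide_le_eq)

text \<open>Multiply by |x| and square. With m = |w|^2, s = |x|^2 and r the real inner product of
  \<open>w\<close> and \<open>x\<close>, the claim becomes (s - 1) 2r \<le> (s - 1)(s + 1). It
  follows from 2r \<le> m + s, as m \<le> 1 < s.\<close>

lemma reflect_disc_mixed:
  assumes "norm w \<le> 1" "norm x > 1"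
  shows "norm (cnj w - 1 / x) \<le> norm (w - x)"
proof -
  have x: "x \<noteq> 0" using assms by auto
  have w1: "(Re w)^2 + (Im w)^2 \<le> 1" 
    using assms by (metis cmod_power2 norm_ge_zero power_le_one)
  have x1: "(Re x)^2 + (Im x)^2 > 1" 
    using assms by (metis cmod_power2 one_less_power zero_less_numeral)
  have "(norm (cnj w * x - 1))^2 \<le> (norm x * norm (w - x))^2"
  proof -
    define s where "s = (Re x)^2 + (Im x)^2"
    define m where "m = (Re w)^2 + (Im w)^2"
    define r where "r = Re w * Re x + Im w * Im x"
    have "0 \<le> (Re w - Re x)^2 + (Im w - Im x)^2" by simp
    then have r: "2 * r \<le> m + s" by (simp add: r_def m_def s_def power2_eq_square algebra_simps)
    have "(norm (cnj w * x - 1))^2 = m * s - 2 * r + 1"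
      unfolding cmod_power2 m_def s_def r_def by (simp add: power2_eq_square algebra_simps)
    moreover have "(norm x * norm (w - x))^2 = s * (m - 2 * r + s)"
      unfolding power_mult_distrib cmod_power2 m_def s_def r_def by (simp add: power2_eq_square algebra_simps)
    moreover have "(s - 1) * (2 * r) \<le> (s - 1) * (s + 1)"
      using r w1 x1 by (intro mult_left_mono) (auto simp: m_def s_def)
    ultimately show ?thesis by (simp add: algebra_simps)
  qed
  then have "norm (cnj w * x - 1) \<le> norm x * norm (w - x)"
    by (rule power2_le_imp_le) simp
  moreover have "cnj w - 1 / x = (cnj w * x - 1) / x" using x by (simp add: field_simps)
  ultimately show ?thesis
    using x by (simp add: norm_divide field_simps)
qed

lemma lipschitz_reflect_disc: "1-lipschitz_on UNIV reflect_disc"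
proof (rule lipschitz_onI)
  fix x y :: complex
  have "norm (reflect_disc x - reflect_disc y) \<le> norm (x - y)"
  proof -
    consider "norm x \<le> 1" "norm y \<le> 1" | "norm x \<le> 1" "norm y > 1" | "norm x > 1" "norm y \<le> 1"
      | "norm x > 1" "norm y > 1" by linarith
    then show ?thesis
    proof cases
      case 1
      then show ?thesis by (simp add: reflect_disc_def) (metis complex_cnj_diff complex_mod_cnj order_refl)
    next
      case 2
      then show ?thesis using reflect_disc_mixed[of x y] by (simp add: reflect_disc_def)
    next
      case 3
      then show ?thesis using reflect_disc_mixed[of y x] by (simp add: reflect_disc_def norm_minus_commute)
    next
      case 4
      then have nz: "x \<noteq> 0" "y \<noteq> 0" by auto
      have "1 * 1 \<le> norm x * norm y" using 4 by (intro mult_mono) auto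
      moreover have "1 / x - 1 / y = - (x - y) / (x * y)" using nz by (simp add: field_simps)
      then have "norm (1 / x - 1 / y) = norm (x - y) / (norm x * norm y)"
        by (simp only: norm_divide norm_minus_cancel norm_mult)
      ultimately show ?thesis using 4 nz
        by (simp add: reflect_disc_def divide_le_eq mult_ge1_I mult_left_le_imp_le mult_le_cancel_left1)
    qed
  qed
  then show "dist (reflect_disc x) (reflect_disc y) \<le> 1 * dist x y" by (simp add: dist_norm)
qed simp

text \<open>The lower bound (1 - k)|x - y| gives injectivity and a Lipschitz inverse. Near-linearity
  holds with the same linear part, the identity, and the same error \<open>k\<close> at every
  point.\<close>

lemma lipschitz_perturbation_of_id:
  fixes H :: "complex \<Rightarrow> complex"
  assumes H: "k-lipschitz_on UNIV H" and k: "k < 1"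
  shows "\<exists>G'. homeomorphism UNIV UNIV (\<lambda>w. w + H w) G'"
    and "lipschitz_near (\<lambda>w. w + H w) z" and "near_linear (\<lambda>w. w + H w) z"
proof -
  define G where "G w = w + H w" for w
  have k0: "0 \<le> k" using H by (rule lipschitz_on_nonneg)
  have Hn: "norm (H x - H y) \<le> k * norm (x - y)" for x y
    using lipschitz_onD[OF H, of x y] by (simp add: dist_norm)
  have low: "(1 - k) * norm (x - y) \<le> norm (G x - G y)" for x y
  proof -
    have "norm (x - y) \<le> norm (G x - G y) + norm (H x - H y)"
      using norm_triangle_ineq4[of "G x - G y" "H x - H y"] by (simp add: G_def)
    then show ?thesis using Hn[of x y] by (simp add: algebra_simps)
  qed
  have up: "norm (G x - G y) \<le> (1 + k) * norm (x - y)" for x y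
  proof -
    have "norm (G x - G y) \<le> norm (x - y) + norm (H x - H y)"
      using norm_triangle_ineq[of "x - y" "H x - H y"] by (simp add: G_def algebra_simps)
    then show ?thesis using Hn[of x y] by (simp add: algebra_simps)
  qed
  have "\<exists>w. G w = y" for y
  proof -
    have "\<exists>!w. y - H w = w"
    proof (rule banach_fix_type[OF k0 k])
      show "\<forall>x x'. dist (y - H x) (y - H x') \<le> k * dist x x'"
        using Hn by (simp add: dist_norm norm_minus_commute)
    qed
    then obtain w where "y - H w = w" by blast
    then show ?thesis by (metis G_def diff_add_cancel)
  qed
  then obtain G' where G': "\<And>y. G (G' y) = y" by metis
  have inv: "G' (G x) = x" for x
  proof -
    have "(1 - k) * norm (G' (G x) - x) \<le> 0" using low[of "G' (G x)" x] G' by simp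
    then show ?thesis using k by (simp add: mult_le_0_iff)
  qed
  have "(1 + k)-lipschitz_on UNIV G"
    using up k0 by (intro lipschitz_onI) (auto simp: dist_norm)
  then have c: "continuous_on UNIV G" by (rule lipschitz_on_continuous_on)
  have "(1 / (1 - k))-lipschitz_on UNIV G'"
  proof (rule lipschitz_onI)
    show "dist (G' x) (G' y) \<le> 1 / (1 - k) * dist x y" for x y
      using low[of "G' x" "G' y"] G' k by (simp add: dist_norm field_simps)
  qed (use k in auto)
  then have c': "continuous_on UNIV G'" by (rule lipschitz_on_continuous_on)
  have "homeomorphism UNIV UNIV G G'"
    unfolding homeomorphism_def using c c' G' inv by (auto intro: range_eqI[of _ G] range_eqI[of _ G'] simp: surj_def) (metis G', metis inv)
  then show "\<exists>G'. homeomorphism UNIV UNIV (\<lambda>w. w + H w) G'" unfolding G_def by blast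
  show "lipschitz_near (\<lambda>w. w + H w) z"
    using up by (intro lipschitz_nearI[of z 1 _ "1 + k"]) (auto simp: G_def)
  show "near_linear (\<lambda>w. w + H w) z"
    unfolding near_linear_def
    using Hn k k0 by (intro exI[of _ 1] exI[of _ k]) auto
qed

subsection \<open>The explicit extension\<close>

lemma has_field_derivative_one_over:
  "z \<noteq> 0 \<Longrightarrow> ((\<lambda>w. 1 / w) has_field_derivative - (1 / z^2)) (at (z::complex))"
  by (auto intro!: derivative_eq_intros simp: power2_eq_square)

lemma holomorphic_one_over: "(\<lambda>w. 1 / w) holomorphic_on (- {0::complex})"
  by (intro holomorphic_intros) auto

lemma deriv_one_over_nz: "z \<noteq> 0 \<Longrightarrow> deriv (\<lambda>w. 1 / w) (z::complex) \<noteq> 0"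
  using DERIV_imp_deriv[OF has_field_derivative_one_over] by simp

lemma qc_at_one_over_post:
  assumes "qc_at k E g z" "g z \<noteq> 0"
  shows "qc_at k E (\<lambda>w. 1 / g w) z"
  using assms deriv_one_over_nz
  by (intro qc_at_post_conformal[OF _ holomorphic_one_over]) (auto simp: open_Compl)

lemma qc_at_one_over_pre:
  assumes "qc_at k (sphere 0 1) g (1 / z)" "z \<noteq> 0"
  shows "qc_at k (sphere 0 1) (\<lambda>w. g (1 / w)) z"
  using assms deriv_one_over_nz
  by (intro qc_at_pre_conformal[OF holomorphic_one_over]) (auto simp: open_Compl norm_divide)

lemma null_sets_unit_circle: "sphere (0::complex) 1 \<in> null_sets lborel"
proof -
  have "sphere (0::complex) 1 \<in> null_sets lebesgue"
    using negligible_sphere negligible_iff_null_sets by blast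
  then show ?thesis by (simp add: null_sets_completion_iff)
qed

lemma qc_at_chart:
  assumes \<Omega>: "open \<Omega>" "finite_dom G = \<Omega>" and eq: "\<And>z. z \<in> \<Omega> \<Longrightarrow> G (Some z) = Some (g z)"
    and qc: "\<And>z. z \<in> \<Omega> \<Longrightarrow> qc_at k (sphere 0 1) g z"
  shows "sense_preserving_on (finite_dom G) (coord_rep G) \<and> dilatation_bound_on k (finite_dom G) (coord_rep G)"
proof -
  have "qc_at k (sphere 0 1) (coord_rep G) z" if z: "z \<in> \<Omega>" for z
  proof (rule qc_at_cong[OF _ qc[OF z]])
    show "\<forall>\<^sub>F w in nhds z. g w = coord_rep G w"
      using eventually_nhds_in_open[OF \<Omega>(1) z]
      by eventually_elim (simp add: coord_rep_def eq)
  qed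
  then show ?thesis
    unfolding \<Omega>(2) using qc_at_imp_local_quasiconformal[OF \<Omega>(1) closed_sphere null_sets_unit_circle] by blast
qed

text \<open>As \<open>G\<close> vanishes only at 0, the chart expressions are \<open>G\<close>,
  \<open>1 / G z\<close>, \<open>G (1 / z)\<close> and \<open>1 / G (1 / z)\<close>, all reached
  from \<open>G\<close> by inversions except the last one at 0. That value depends on
  \<open>G\<close> near infinity, hence the separate assumption there.\<close>

lemma quasiconformal_sphere_inv_conjugate:
  assumes k: "0 \<le> k" "k < 1" and G: "homeomorphism UNIV UNIV G G'" and G0: "G 0 = 0"
    and qc: "\<And>w. qc_at k (sphere 0 1) G w"
    and qc0: "qc_at k (sphere 0 1) (\<lambda>z. if z = 0 then 0 else 1 / G (1 / z)) 0"
  shows "quasiconformal_sphere k (sphere_inv \<circ> map_option G \<circ> sphere_inv)"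
proof -
  define F where "F = sphere_inv \<circ> map_option G \<circ> sphere_inv"
  define F0 where "F0 z = (if z = 0 then 0 else 1 / G (1 / z))" for z
  have nz: "G w = 0 \<longleftrightarrow> w = 0" for w
    using G G0 by (metis homeomorphism_apply1 UNIV_I)
  have homeo: "homeomorphic_map riemann_sphere riemann_sphere F"
    unfolding F_def
    using homeomorphic_map_sphere_inv homeomorphic_map_map_option_riemann_sphere[OF G]
    by (intro homeomorphic_map_compose)
  have qcF0: "qc_at k (sphere 0 1) F0 z" for z
  proof (cases "z = 0")
    case True
    then show ?thesis using qc0 unfolding F0_def by simp
  next
    case False
    have "qc_at k (sphere 0 1) (\<lambda>z. 1 / G (1 / z)) z"
      using qc False nz by (intro qc_at_one_over_post qc_at_one_over_pre) auto
    moreover have "\<forall>\<^sub>F w in nhds z. 1 / G (1 / w) = F0 w"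
      using t1_space_nhds[OF False] by eventually_elim (simp add: F0_def)
    ultimately show ?thesis by (metis qc_at_cong)
  qed
  have FS: "F (Some z) = Some (F0 z)" for z
    using nz by (cases "z = 0") (auto simp: F_def F0_def G0)
  have FN: "F None = None" by (simp add: F_def G0)
  have Fi: "F (Some (1 / z)) = Some (1 / G z)" if "z \<noteq> 0" for z
    using that nz by (simp add: FS F0_def)
  have iF: "sphere_inv (F (Some z)) = (if z = 0 then None else Some (G (1 / z)))" for z
    by (cases "z = 0") (auto simp: F_def)
  have iFi: "sphere_inv (F (sphere_inv (Some z))) = Some (G z)" for z
    by (simp add: F_def)
  let ?P = "\<lambda>G. sense_preserving_on (finite_dom G) (coord_rep G) \<and> dilatation_bound_on k (finite_dom G) (coord_rep G)"
  have 1: "?P (id \<circ> F \<circ> id)"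
    using qcF0 by (intro qc_at_chart[of UNIV _ F0]) (auto simp: FS finite_dom_def)
  have 2: "?P (id \<circ> F \<circ> sphere_inv)"
    using qc nz by (intro qc_at_chart[of "- {0}" _ "\<lambda>z. 1 / G z"] qc_at_one_over_post)
      (auto simp: FN Fi finite_dom_def open_Compl sphere_inv_def split: if_splits)
  have 3: "?P (sphere_inv \<circ> F \<circ> id)"
    using qc nz by (intro qc_at_chart[of "- {0}" _ "\<lambda>z. G (1 / z)"] qc_at_one_over_pre)
      (auto simp: iF finite_dom_def open_Compl)
  have 4: "?P (sphere_inv \<circ> F \<circ> sphere_inv)"
    using qc by (intro qc_at_chart[of UNIV _ G]) (auto simp: iFi finite_dom_def)
  show ?thesis
    unfolding F_def[symmetric] quasiconformal_sphere_def Let_def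
    using k homeo 1 2 3 4 by blast
qed

text \<open>Writing f z = z (1 + z r z), the difference 1/f z - 1/z equals - r z / (1 + z r z), and
  the denominator vanishes only at zeros of \<open>f\<close> other than 0.\<close>

lemma class_A_reciprocal:
  fixes f :: "complex \<Rightarrow> complex" and a :: "nat \<Rightarrow> complex"
  assumes lam: "lam < 1"
    and f: "f \<in> class_A"
    and series: "\<And>z. norm z < 1 \<Longrightarrow> (\<lambda>n. a (n + 2) * z ^ (n + 2)) sums (f z - z)"
    and a2: "a 2 = 0"
    and U: "\<And>z. norm z < 1 \<Longrightarrow> norm (U_op f z) \<le> lam * (norm z)^2"
  obtains h where "h holomorphic_on ball 0 1" "h 0 = 0"
    "\<And>z. z \<in> ball 0 1 \<Longrightarrow> norm (deriv h z) \<le> lam"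
    "\<And>z. z \<in> ball 0 1 \<Longrightarrow> z \<noteq> 0 \<Longrightarrow> f z \<noteq> 0 \<and> 1 / f z = 1 / z + h z"
proof -
  \<comment> \<open>The value at 0 is the coefficient \<open>a 2 = 0\<close>, so \<open>r\<close> is
    the sum of its power series at 0 as well; this also gives \<open>h 0 = 0\<close>.\<close>
  define r where "r z = (if z = 0 then 0 else (f z - z) / z^2)" for z
  have r: "(\<lambda>n. a (n + 2) * z ^ n) sums r z" if "norm z < 1" for z
  proof (cases "z = 0")
    case True
    have "(\<lambda>n. a (n + 2) * 0 ^ n) sums a (0 + 2)" using powser_sums_zero[of "\<lambda>n. a (n + 2)"] by simp
    then show ?thesis using True a2 by (simp add: r_def numeral_2_eq_2)
  next
    case False
    have "(\<lambda>n. a (n + 2) * z ^ (n + 2) / z^2) sums ((f z - z) / z^2)"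
      using series[OF that] by (rule sums_divide)
    then show ?thesis using False by (simp add: r_def power_add power2_eq_square)
  qed
  have rhol: "r holomorphic_on ball 0 1"
    by (rule power_series_holomorphic[of 0 1 "\<lambda>n. a (n + 2)"]) (use r in auto)
  have fr: "f z = z * (1 + z * r z)" for z
    using f by (auto simp: r_def class_A_def field_simps power2_eq_square)
  have fnz: "f z \<noteq> 0" if z: "norm z < 1" "z \<noteq> 0" for z
  proof
    assume "f z = 0"
    \<comment> \<open>The convention \<open>x / 0 = 0\<close> replaces the pole by the value -1,
      whose modulus exceeds the bound.\<close>
    then have "U_op f z = -1" using z by (simp add: U_op_def z_over_def)
    then have "1 \<le> lam * (norm z)^2" using U[OF z(1)] by simp
    moreover have "lam * (norm z)^2 < 1"
    proof (cases "lam \<le> 0")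
      case True
      then have "lam * (norm z)^2 \<le> 0" by (simp add: mult_le_0_iff)
      then show ?thesis by simp
    next
      case False
      have "(norm z)^2 \<le> 1" using z by (simp add: power_le_one)
      then have "lam * (norm z)^2 \<le> lam * 1" using False by (intro mult_left_mono) auto
      then show ?thesis using lam by simp
    qed
    ultimately show False by simp
  qed
  have qnz: "1 + z * r z \<noteq> 0" if "norm z < 1" for z
    using fnz[OF that] fr[of z] by (cases "z = 0") auto
  define h where "h z = - r z / (1 + z * r z)" for z
  have hhol: "h holomorphic_on ball 0 1"
    unfolding h_def using qnz by (intro holomorphic_intros rhol) auto
  have h0: "h 0 = 0" by (simp add: h_def r_def)
  have rec: "1 / f z = 1 / z + h z" if "norm z < 1" "z \<noteq> 0" for z
    using qnz[OF that(1)] that(2) by (simp add: fr[of z] h_def field_simps)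
  have hd: "(h has_field_derivative deriv h z) (at z)" if "norm z < 1" for z
    using hhol that by (intro holomorphic_derivI[OF hhol open_ball]) auto
  \<comment> \<open>The derivative of \<open>1 / f\<close> is computed twice, directly and from
    \<open>1 / z + h z\<close>, and the results are compared after multiplication by z^2.\<close>
  have U_h: "U_op f z = - (z^2 * deriv h z)" if z: "norm z < 1" "z \<noteq> 0" for z
  proof -
    have "(f has_field_derivative deriv f z) (at z)"
      using f z by (intro holomorphic_derivI[of f "ball 0 1"]) (auto simp: class_A_def)
    then have "((\<lambda>w. 1 / f w) has_field_derivative - (deriv f z / (f z)^2)) (at z)"
      using fnz[OF z] by (auto intro!: derivative_eq_intros simp: power2_eq_square)
    moreover have "((\<lambda>w. 1 / f w) has_field_derivative - (1 / z^2) + deriv h z) (at z)"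
    proof (rule has_field_derivative_transform_within_open)
      show "((\<lambda>w. 1 / w + h w) has_field_derivative - (1 / z^2) + deriv h z) (at z)"
        using hd[OF z(1)] has_field_derivative_one_over[OF z(2)] by (rule DERIV_add[rotated])
      show "open (ball 0 1 - {0::complex})" by (intro open_Diff) auto
      show "1 / w + h w = 1 / f w" if "w \<in> ball 0 1 - {0}" for w using rec[of w] that by auto
    qed (use z in auto)
    ultimately have "- (deriv f z / (f z)^2) = - (1 / z^2) + deriv h z" by (rule DERIV_unique)
    then have "deriv f z / (f z)^2 = 1 / z^2 - deriv h z" by (simp add: algebra_simps)
    then have "z^2 * (deriv f z / (f z)^2) = z^2 * (1 / z^2 - deriv h z)" by (simp only:)
    then have "z^2 * (deriv f z / (f z)^2) = 1 - z^2 * deriv h z"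
      using z(2) by (simp add: right_diff_distrib)
    then show ?thesis using z(2) by (simp add: U_op_def z_over_def power_divide)
  qed
  have hb: "norm (deriv h z) \<le> lam" if z: "norm z < 1" "z \<noteq> 0" for z
    using U[OF z(1)] z(2) by (simp add: U_h[OF z] norm_mult norm_power)
  \<comment> \<open>At 0 the factor |z|^2 cannot be cancelled; the bound passes to the limit by
    continuity of \<open>deriv h\<close>.\<close>
  have hb0: "norm (deriv h 0) \<le> lam"
  proof (rule tendsto_upperbound)
    have "continuous_on (ball 0 1) (deriv h)"
      by (intro holomorphic_on_imp_continuous_on holomorphic_deriv hhol open_ball)
    then have "isCont (deriv h) 0" by (simp add: continuous_on_eq_continuous_at)
    then show "((\<lambda>z. norm (deriv h z)) \<longlongrightarrow> norm (deriv h 0)) (at 0)"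
      by (intro tendsto_norm) (simp add: isCont_def)
    have "\<forall>\<^sub>F z in at (0::complex). z \<in> ball 0 1 - {0}"
      by (rule eventually_at_in_open) auto
    then show "\<forall>\<^sub>F z in at 0. norm (deriv h z) \<le> lam"
      by eventually_elim (use hb in auto)
  qed simp
  show thesis
  proof (rule that[OF hhol h0])
    show "norm (deriv h z) \<le> lam" if "z \<in> ball 0 1" for z
      using hb[of z] hb0 that by (cases "z = 0") auto
    show "f z \<noteq> 0 \<and> 1 / f z = 1 / z + h z" if "z \<in> ball 0 1" "z \<noteq> 0" for z
      using fnz[of z] rec[of z] that by auto
  qed
qed

text \<open>In the disc the reflection is antiholomorphic, so the identity contributes
  \<open>p = 1\<close> and \<open>h\<close> contributes only to \<open>q\<close>. Outside it is
  holomorphic and \<open>q = 0\<close>. \<open>H\<close> stands for a Lipschitz extension of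
  \<open>h\<close> to the closed disc.\<close>

lemma dilatation_at_reflected_perturbation:
  assumes h: "h holomorphic_on ball 0 1" and hb: "\<And>z. z \<in> ball 0 1 \<Longrightarrow> norm (deriv h z) \<le> k"
    and H: "\<And>z. z \<in> ball 0 1 \<Longrightarrow> H z = h z" and k: "0 \<le> k" and w: "norm w \<noteq> 1"
  shows "dilatation_at k (\<lambda>w. w + H (reflect_disc w)) w"
proof (cases "norm w < 1")
  case True
  let ?d = "deriv h (cnj w)"
  have "(h has_derivative (*) ?d) (at (cnj w))"
    using True has_field_derivative_imp_has_derivative[OF holomorphic_derivI[OF h open_ball]] by auto
  then have "((\<lambda>w. h (cnj w)) has_derivative (\<lambda>v. ?d * cnj v)) (at w)"
    using has_derivative_compose[of cnj cnj w UNIV h] bounded_linear_imp_has_derivative[OF bounded_linear_cnj]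
    by blast
  then have "((\<lambda>w. w + h (cnj w)) has_derivative (\<lambda>v. 1 * v + ?d * cnj v)) (at w)"
    by (auto intro!: derivative_eq_intros)
  then have "((\<lambda>w. w + H (reflect_disc w)) has_derivative (\<lambda>v. 1 * v + ?d * cnj v)) (at w)"
    by (rule has_derivative_transform_within_open[of _ _ _ _ "ball 0 1"])
      (use True H in \<open>auto simp: reflect_disc_def\<close>)
  moreover have "norm ?d \<le> k * norm (1::complex)" using hb[of "cnj w"] True by simp
  ultimately show ?thesis unfolding dilatation_at_def by blast
next
  case False
  then have n: "norm w > 1" using w by simp
  then have w0: "w \<noteq> 0" by auto
  have m: "1 / x \<in> ball 0 1" if "x \<in> - cball 0 1" for x :: complex
    using that by (auto simp: norm_divide divide_less_eq)
  let ?d = "deriv h (1 / w)"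
  have "(h has_field_derivative ?d) (at (1 / w))"
    using m[of w] n by (intro holomorphic_derivI[OF h open_ball]) auto
  then have "((\<lambda>w. h (1 / w)) has_field_derivative ?d * (- (1 / w^2))) (at w)"
    using has_field_derivative_one_over[OF w0] by (rule DERIV_chain2)
  then have "((\<lambda>w. w + h (1 / w)) has_field_derivative 1 + ?d * (- (1 / w^2))) (at w)"
    by (intro DERIV_add DERIV_ident)
  then have "((\<lambda>w. w + H (reflect_disc w)) has_field_derivative 1 + ?d * (- (1 / w^2))) (at w)"
    by (rule has_field_derivative_transform_within_open[of _ _ _ "- cball 0 1"])
      (use n H m in \<open>auto simp: reflect_disc_def open_Compl\<close>)
  then have "((\<lambda>w. w + H (reflect_disc w)) has_derivative (*) (1 + ?d * (- (1 / w^2)))) (at w)"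
    by (rule has_field_derivative_imp_has_derivative)
  then show ?thesis unfolding dilatation_at_def
    using k by (intro exI[of _ "1 + ?d * (- (1 / w^2))"] exI[of _ 0]) simp
qed

theorem theorem2:
  fixes lam :: real and f :: "complex \<Rightarrow> complex" and a :: "nat \<Rightarrow> complex"
  assumes "0 < lam" and "lam < 1"
    and "f \<in> class_A"
    and "\<And>z. norm z < 1 \<Longrightarrow> (\<lambda>n. a (n + 2) * z ^ (n + 2)) sums (f z - z)"
    and "a 2 = 0"
    and "\<exists>z\<in>ball 0 1. U_op f z \<noteq> 0"
    and "\<And>z. norm z < 1 \<Longrightarrow> norm (U_op f z) \<le> lam * (norm z)^2"
  shows "\<exists>F fhat.
           qc_extension lam (ball 0 1) f F \<and>
           closed_disc_extension f fhat \<and>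
           (\<forall>z. norm z < 1 \<longrightarrow> F (Some z) = Some (f z)) \<and>
           (\<forall>z. norm z \<ge> 1 \<longrightarrow> F (Some z) = exterior_formula z (fhat (1 / cnj z))) \<and>
           limitin riemann_sphere (\<lambda>z. exterior_formula z (fhat (1 / cnj z))) (F None) at_infinity"
proof -
  have f: "f holomorphic_on ball 0 1" "f 0 = 0" "deriv f 0 = 1"
    using assms(3) by (auto simp: class_A_def)
  obtain h where h: "h holomorphic_on ball 0 1" "h 0 = 0"
    and hb: "\<And>z. z \<in> ball 0 1 \<Longrightarrow> norm (deriv h z) \<le> lam"
    and fh: "\<And>z. z \<in> ball 0 1 \<Longrightarrow> z \<noteq> 0 \<Longrightarrow> f z \<noteq> 0 \<and> 1 / f z = 1 / z + h z"
    using class_A_reciprocal[OF assms(2-5,7)] by blast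
  have "lam-lipschitz_on (ball 0 1) h"
  proof (rule lipschitz_onI)
    fix x y :: complex assume "x \<in> ball 0 1" "y \<in> ball 0 1"
    then have "norm (h x - h y) \<le> lam * norm (x - y)"
      using holomorphic_derivI[OF h(1) open_ball]
      by (intro field_differentiable_bound[OF convex_ball[of 0 1] _ hb])
    then show "dist (h x) (h y) \<le> lam * dist x y" by (simp add: dist_norm)
  qed (use assms in simp)
  \<comment> \<open>The extension defines the perturbation on the unit circle and thereby supplies
    the boundary values of \<open>f\<close>.\<close>
  then obtain hh where "lam-lipschitz_on (closure (ball 0 1)) hh" 
    and hh: "\<And>z. z \<in> ball 0 1 \<Longrightarrow> hh z = h z"
    using lipschitz_extend_closure by metis
  then have hhL: "lam-lipschitz_on (cball 0 1) hh" by simp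
  define H where "H w = hh (reflect_disc w)" for w
  define G where "G w = w + H w" for w
  have HL: "lam-lipschitz_on UNIV H"
  proof -
    have "lam-lipschitz_on (reflect_disc ` UNIV) hh"
      using hhL by (rule lipschitz_on_subset) (use reflect_disc_mem in blast)
    from lipschitz_on_compose2[OF lipschitz_reflect_disc this]
    show ?thesis unfolding H_def by simp
  qed
  obtain G' where homeo: "homeomorphism UNIV UNIV G G'"
    using lipschitz_perturbation_of_id(1)[OF HL assms(2)] unfolding G_def by blast
  have G0: "G 0 = 0" using hh[of 0] h(2) by (simp add: G_def H_def reflect_disc_def)
  have qc: "qc_at lam (sphere 0 1) G w" for w
    unfolding qc_at_def G_def
    using lipschitz_perturbation_of_id(2,3)[OF HL assms(2)]
      dilatation_at_reflected_perturbation[OF h(1) hb hh, of w] assms(1)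
    unfolding H_def by simp
  define F where "F = sphere_inv \<circ> map_option G \<circ> sphere_inv"
  define F0 where "F0 z = (if z = 0 then 0 else 1 / G (1 / z))" for z
  have nz: "G w = 0 \<longleftrightarrow> w = 0" for w
    using homeo G0 by (metis homeomorphism_apply1 UNIV_I)
  have FS: "F (Some z) = Some (F0 z)" for z
    using nz by (cases "z = 0") (auto simp: F_def F0_def G0)
  have FN: "F None = None" by (simp add: F_def G0)
  \<comment> \<open>For z in the disc other than 0, \<open>1 / z\<close> lies outside it and is
    reflected to \<open>z\<close>, so \<open>G (1 / z)\<close> is
    \<open>1 / z + h z = 1 / f z\<close>.\<close>
  have F0f: "F0 z = f z" if z: "z \<in> ball 0 1" for z
  proof (cases "z = 0")
    case False
    have "G (1 / z) = 1 / z + h z"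
    proof -
      have "norm (1 / z) > 1" using z False by (simp add: norm_divide)
      then show ?thesis using hh[OF z] by (simp add: G_def H_def reflect_disc_def)
    qed
    then show ?thesis using fh[OF z False] False by (simp add: F0_def) (metis div_by_1 divide_divide_eq_right mult_1)
  qed (simp add: F0_def f)
  have qc0: "qc_at lam (sphere 0 1) F0 0"
  proof (rule qc_at_cong)
    show "qc_at lam (sphere 0 1) f 0"
      using f assms(1) by (intro holomorphic_qc_at[of f "ball 0 1"]) auto
    show "\<forall>\<^sub>F w in nhds 0. f w = F0 w"
      using eventually_nhds_in_open[of "ball 0 1" "0::complex"]
      by (auto simp: F0f elim: eventually_mono)
  qed
  have qcF: "quasiconformal_sphere lam F"
    unfolding F_def
    using assms homeo G0 qc qc0[unfolded F0_def[abs_def]] 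
    by (intro quasiconformal_sphere_inv_conjugate) auto
  then have homeoF: "homeomorphic_map riemann_sphere riemann_sphere F"
    by (simp add: quasiconformal_sphere_def)
  then have contF: "continuous_map riemann_sphere riemann_sphere F"
    by (rule homeomorphic_imp_continuous_map)
  have "inj F" using homeoF by (simp add: homeomorphic_eq_everything_map)
  then have "inj_on f (ball 0 1)"
    using F0f FS by (metis injD inj_onI option.inject)
  \<comment> \<open>On the circle these are the boundary values of \<open>f\<close>; their
    continuity is inherited from \<open>F\<close>.\<close>
  define fhat where "fhat z = F (Some z)" for z
  have fhat_cont: "continuous_map (top_of_set (cball 0 1)) riemann_sphere fhat"
    unfolding fhat_def
    using continuous_map_compose[OF continuous_map_Some_riemann_sphere contF]
    by (simp add: o_def continuous_map_from_subtopology)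
  have ext: "F (Some z) = exterior_formula z (fhat (1 / cnj z))" if z: "norm z \<ge> 1" for z
  proof (cases "norm z = 1")
    case True
    \<comment> \<open>A point of the circle is its own reflection, and the coefficient |z|^2 - 1
      vanishes there, so the formula returns \<open>fhat z\<close>.\<close>
    then have "z * cnj z = 1" by (simp add: complex_norm_square[symmetric])
    then have "1 / cnj z = z" by (metis divide_eq_eq mult_zero_right zero_neq_one)
    moreover have "z \<noteq> 0" using True by auto
    ultimately show ?thesis using True by (simp add: fhat_def FS exterior_formula_def sphere_quotient_def)
  next
    case False
    define u where "u = 1 / cnj z"
    define s where "s = complex_of_real ((norm z)^2 - 1)"
    have z0: "z \<noteq> 0" using z by auto
    have zz: "z * cnj z = s + 1" using complex_norm_square[of z] by (simp add: s_def)
    have u: "u \<in> ball 0 1" "u \<noteq> 0" using z False z0 by (auto simp: u_def norm_divide)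
    have "norm (1 / z) \<le> 1" using z by (simp add: norm_divide divide_le_eq)
    moreover have "cnj (1 / z) = u" by (simp add: u_def)
    ultimately have Gz: "G (1 / z) = 1 / z + h u" using hh[OF u(1)] by (simp add: G_def H_def reflect_disc_def)
    have w: "f u \<noteq> 0" "1 / f u = 1 / u + h u" using fh[OF u] by auto
    have "h u = 1 / f u - cnj z" using w(2) by (simp add: u_def)
    then have "G (1 / z) = 1 / z + 1 / f u - cnj z" by (simp add: Gz)
    then have "(z * f u) * G (1 / z) = f u + z - (z * cnj z) * f u"
      using z0 w(1) by (simp add: field_simps)
    \<comment> \<open>The denominator of the formula is its numerator times
      \<open>G (1 / z)\<close>, which is nonzero because \<open>G\<close> vanishes only at 0. So the
      quotient is finite and equals \<open>1 / G (1 / z)\<close>.\<close>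
    then have key: "z - s * f u = (z * f u) * G (1 / z)" by (simp add: zz algebra_simps)
    have Gnz: "G (1 / z) \<noteq> 0" using nz z0 by simp
    have "exterior_formula z (fhat u) = sphere_quotient (z * f u) (z - s * f u)"
      using u F0f[OF u(1)] by (simp add: fhat_def FS exterior_formula_def s_def)
    also have "\<dots> = Some (1 / G (1 / z))"
      unfolding key sphere_quotient_def using z0 w(1) Gnz by simp
    also have "\<dots> = F (Some z)" using z0 by (simp add: FS F0_def)
    finally show ?thesis by (simp add: u_def)
  qed
  have "limitin riemann_sphere (F \<circ> Some) (F None) at_infinity"
    using contF limitin_Some_at_infinity by (rule continuous_map_limit)
  moreover have "\<forall>\<^sub>F z in at_infinity. (F \<circ> Some) z = exterior_formula z (fhat (1 / cnj z))"
    unfolding eventually_at_infinity using ext by (auto intro!: exI[of _ 1])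
  ultimately have lim: "limitin riemann_sphere (\<lambda>z. exterior_formula z (fhat (1 / cnj z))) (F None) at_infinity"
    by (rule limitin_transform_eventually[rotated])
  have Ff: "F (Some z) = Some (f z)" if "norm z < 1" for z
    using that F0f by (simp add: FS)
  have "qc_extension lam (ball 0 1) f F"
    unfolding qc_extension_def using f(1) \<open>inj_on f (ball 0 1)\<close> qcF Ff by auto
  moreover have "closed_disc_extension f fhat"
    unfolding closed_disc_extension_def using fhat_cont Ff by (simp add: fhat_def)
  ultimately show ?thesis using Ff ext lim by blast
qed

end
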